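(* Let $\Omega\subset\mathbb{R}^2$, $T>0$, $A,B\in\mathbb{R}^{m\times m}$, the mesh $\mathcal{M}_h$, the set $\mathcal{I}\subset\mathcal{M}_h$ of stabilized small cut-cells, the parameters $\eta_{E_{\text{cut}}}\in[0,1]$, the weights $\omega_i=\omega_i^{E_{\text{cut}}}\in\mathbb{R}^{m\times m}$, the space $\mathcal{V}_h^0(\mathcal{M}_h)$ and the forms $a_h^{\text{upw}}$, $J_h^0$, $l_h$ be as defined in the context. Consider the hyperbolic system $u_t+Au_x+Bu_y=0$ in $\Omega\times(0,T)$ with homogeneous inflow boundary conditions ($g=0$, hence $l_h=0$). Let $u_h(t)\in\mathcal{V}_h^0(\mathcal{M}_h)$ be the solution of the stabilized semi-discrete problem $$(\partial_t u_h(t),v_h)_{L^2(\Omega)}+a_h^{\text{upw}}(u_h(t),v_h)+J_h^0(u_h(t),v_h)+l_h(v_h)=0\qquad\forall\, v_h\in\mathcal{V}_h^0(\mathcal{M}_h),$$ and assume that $u_h(t)$ vanishes on the boundary $\partial\Omega$ for all $t\in(0,T)$ (i.e. $u_h(t)$ is zero on every cell of $\mathcal{M}_h$ having an external face). Then $$\|u_h(t)\|_{L^2(\Omega)}\le\|u_h(0)\|_{L^2(\Omega)}\qquad\forall\, t\in(0,T).$$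
   Context: **Continuous problem.** $\Omega\subset\mathbb{R}^2$ is an open, connected (bounded, polygonal) domain. The system is $u_t+Au_x+Bu_y=0$ in $\Omega\times(0,T)$, with boundary condition $\tau u=g$ on $\partial\Omega\times(0,T)$ (where $\tau$ imposes data only on incoming waves) and $u=u_0$ at $t=0$. Here $u(t)$ takes values in $\mathbb{R}^m$ and $A,B\in\mathbb{R}^{m\times m}$ are constant. It is assumed that the matrices $n_1A+n_2B$, $n=(n_1,n_2)^T\in\mathbb{S}^1$, are symmetric and simultaneously diagonalizable: there are one orthogonal matrix $O\in\mathbb{R}^{m\times m}$ and real diagonal matrices $\Lambda_n$ with $n_1A+n_2B=O\Lambda_nO^T$ for all $n\in\mathbb{S}^1$. $\langle\cdot,\cdot\rangle$ is the scalar product of $\mathbb{R}^m$. **Mesh.** $\mathcal{M}_h$ is a (finite) cut-cell mesh of $\Omega$, i.e. a partition of $\Omega$ into polygonal cells, with faces being straight segments. Internal faces: $\mathcal{F}_h^{\text{int}}=\{F=\partial E_1\cap\partial E_2 : E_1,E_2\in\mathcal{M}_h,\ E_1\ne E_2,\ |F|>0\}$. External faces: $\mathcal{F}_h^{\text{ext}}=\{F=\partial E\cap\partial\Omega : E\in\mathcal{M}_h,\ |F|>0\}$. The faces of a cell $E$ are $\mathcal{F}_h^E=\{F\in\mathcal{F}_h^{\text{int}}\cup\mathcal{F}_h^{\text{ext}} : F\subset\partial E\}$, with a fixed local numbering; the neighbor of $E$ across $F_i\in\mathcal{F}_h^E$ is denoted $E_i$. Discrete functions have value $0$ on the (non-existent)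 outer neighbor across an external face. **Discrete space.** $\mathcal{V}_h^0(\mathcal{M}_h)=\{v_h\in L^2(\Omega)^m : (v_h)_i|_E \text{ is constant for all } E\in\mathcal{M}_h,\ i=1,\dots,m\}$. $v_h^E\in\mathbb{R}^m$ denotes the value of $v_h$ on $E$. The solution $u_h$ is a (differentiable in time) function of $t$, continuous up to $t=0$. **Traces and flux matrices.** For $F\in\mathcal{F}_h^{\text{int}}$ a unit normal $n_F$ is fixed, pointing from the inner element $E_1$ to the outer element $E_2$, and $\{\!\{u_h\}\!\}=\frac12(u_h^{E_1}+u_h^{E_2})$, $[\![u_h]\!]=u_h^{E_1}-u_h^{E_2}$. For $F\in\mathcal{F}_h^{\text{ext}}$, $n_F$ is the unit outer normal of $\Omega$ and $u_h^{E_F}$ is the value on the cell $E_F$ containing the face $F$. Set $C_F=(n_F)_1A+(n_F)_2B=O\Lambda_FO^T$, $C_F^{\pm}=O\Lambda_F^{\pm}O^T$ with $(\Lambda_F^+)_{i,i}=\max(0,(\Lambda_F)_{i,i})$, $(\Lambda_F^-)_{i,i}=\min(0,(\Lambda_F)_{i,i})$ ($\Lambda_F^\pm$ diagonal), and $|C_F|=C_F^+-C_F^-$. **Upwind forms.** $$a_h^{\text{upw}}(u_h,v_h)=\sum_{F\in\mathcal{F}_h^{\text{ext}}}\int_F\langle C_F^+u_h^{E_F},v_h^{E_F}\rangle\,ds+\sum_{F\in\mathcal{F}_h^{\text{int}}}\int_F\Big(\langle C_F\{\!\{u_h\}\!\},[\![v_h]\!]\rangle+\tfrac12\langle|C_F|[\![u_h]\!],[\![v_h]\!]\rangle\Big)ds,$$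 $$l_h(v_h)=-\sum_{F\in\mathcal{F}_h^{\text{ext}}}\int_F\langle C_F^-g,v_h^{E_F}\rangle\,ds.$$ **DoD stabilization.** $\mathcal{I}\subset\mathcal{M}_h$ is the set of small cut-cells that require stabilization, and $J_h^0=\sum_{E_{\text{cut}}\in\mathcal{I}}J_h^{0,E_{\text{cut}}}$ with $$J_h^{0,E_{\text{cut}}}(u_h,v_h)=\eta_{E_{\text{cut}}}\sum_{F_j\in\mathcal{F}_h^{E_{\text{cut}}}}\int_{F_j}\sum_{F_i\in\mathcal{F}_h^{E_{\text{cut}}}}\big\langle\omega_iC_{F_j}^+\big(u_h^{E_i}-u_h^{E_{\text{cut}}}\big),\,v_h^{E_{\text{cut}}}-v_h^{E_j}\big\rangle\,ds .$$ In this formula and in the conditions below, all normals on the faces of $E_{\text{cut}}$ (and hence $C_{F_j}$, $C_{F_j}^\pm$) are the outward unit normals with respect to $E_{\text{cut}}$. For each $E_{\text{cut}}\in\mathcal{I}$ the parameter satisfies $\eta_{E_{\text{cut}}}\in[0,1]$, and the weights $\omega_i\in\mathbb{R}^{m\times m}$ (one for each $F_i\in\mathcal{F}_h^{E_{\text{cut}}}$) satisfy: 1. $\sum_{F_i\in\mathcal{F}_h^{E_{\text{cut}}}}\omega_i=\mathrm{Id}_{m\times m}$; 2. $\sum_{F_j\in\mathcal{F}_h^{E_{\text{cut}}}}\int_{F_j}\omega_iC_{F_j}^+\,ds=-\int_{F_i}C_{F_i}^-\,ds$ for all $F_i\in\mathcal{F}_h^{E_{\text{cut}}}$; 3. $\omega_iC_{F_j}^+$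 is symmetric and positive semi-definite for all $F_i,F_j\in\mathcal{F}_h^{E_{\text{cut}}}$. In the scalar case $m=1$ the $\omega_i$ are moreover required to form a convex combination ($\omega_i\ge0$, $\sum_i\omega_i=1$).
   Formalization: Stabilized cells sharing a face are assumed to each have an external face (as cells cut by the boundary of Ω do); for an arbitrary subset I of the mesh the estimate can fail, e.g. for three stabilized interior cells in a row with η=1. *)

theory Defs
  imports "HOL-Analysis.Analysis"
begin

type_synonym plane = "real^2"

section \<open>Meshes\<close>

text \<open>Polygons need not be convex or simply connected. The condition that \<open>P\<close> is the interior of
  its closure rules out slits, so that at all but finitely many points of its boundary the set
  lies on exactly one side.\<close>

definition polygonal :: "plane set \<Rightarrow> bool" where
  "polygonal P \<longleftrightarrow> open P \<and> connected P \<and> bounded P \<and> P \<noteq> {} \<and> interior (closure P) = P \<and>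
     (\<exists>S. finite S \<and> (\<forall>s\<in>S. \<exists>a b. s = closed_segment a b) \<and> frontier P = \<Union>S)"

text \<open>The maximal nondegenerate segments contained in \<open>X\<close>. If \<open>X\<close> is itself such a segment, it
  is the only one (lemma below). If \<open>X\<close> has corners, as \<open>\<partial>E \<inter> \<partial>\<Omega>\<close> has for a cell \<open>E\<close> in a corner
  of \<open>\<Omega>\<close>, each straight part counts as a face of its own, with its own normal.\<close>

definition straight_pieces :: "plane set \<Rightarrow> plane set set" where
  "straight_pieces X = {closed_segment a b | a b. a \<noteq> b \<and> closed_segment a b \<subseteq> X \<and>
     (\<forall>c d. closed_segment a b \<subseteq> closed_segment c d \<and> closed_segment c d \<subseteq> X
        \<longrightarrow> closed_segment c d = closed_segment a b)}"

lemma straight_pieces_segment: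
  assumes "a \<noteq> b"
  shows "straight_pieces (closed_segment a b) = {closed_segment a b}"
  using assms unfolding straight_pieces_def by blast

definition int_faces :: "plane set set \<Rightarrow> plane set set" where
  "int_faces M = (\<Union>E1\<in>M. \<Union>E2\<in>M - {E1}. straight_pieces (frontier E1 \<inter> frontier E2))"

definition ext_faces :: "plane set \<Rightarrow> plane set set \<Rightarrow> plane set set" where
  "ext_faces \<Omega> M = (\<Union>E\<in>M. straight_pieces (frontier E \<inter> frontier \<Omega>))"

definition cell_faces :: "plane set \<Rightarrow> plane set set \<Rightarrow> plane set \<Rightarrow> plane set set" where
  "cell_faces \<Omega> M E = {F \<in> int_faces M \<union> ext_faces \<Omega> M. F \<subseteq> frontier E}"

text \<open>Finitely many exceptional points are allowed, where further vertices may touch \<open>F\<close>.\<close>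

definition is_outer_normal :: "plane set \<Rightarrow> plane set \<Rightarrow> plane \<Rightarrow> bool" where
  "is_outer_normal P F n \<longleftrightarrow> norm n = 1 \<and> (\<forall>x\<in>F. \<forall>y\<in>F. n \<bullet> (x - y) = 0) \<and>
     finite {x\<in>F. \<not> (\<forall>\<^sub>F e in at_right 0. x - e *\<^sub>R n \<in> P \<and> x + e *\<^sub>R n \<notin> P)}"

definition outer_normal :: "plane set \<Rightarrow> plane set \<Rightarrow> plane" where
  "outer_normal P F = (THE n. is_outer_normal P F n)"

text \<open>The last clause says that normals to the faces exist. It only excludes cells touching
  themselves in a point through which a face runs straight on while the cell changes sides.\<close>

definition is_mesh :: "plane set \<Rightarrow> plane set set \<Rightarrow> bool" where
  "is_mesh \<Omega> M \<longleftrightarrow> finite M \<and> (\<forall>E\<in>M. polygonal E \<and> E \<subseteq> \<Omega>) \<and> pairwise disjnt M \<and>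
     closure \<Omega> = (\<Union>E\<in>M. closure E) \<and>
     (\<forall>E\<in>M. \<forall>F\<in>cell_faces \<Omega> M E. \<exists>n. is_outer_normal E F n)"

definition neighbor :: "plane set set \<Rightarrow> plane set \<Rightarrow> plane set \<Rightarrow> plane set" where
  "neighbor M E F = (THE E'. E' \<in> M \<and> E' \<noteq> E \<and> F \<subseteq> frontier E')"

definition ext_cell :: "plane set set \<Rightarrow> plane set \<Rightarrow> plane set" where
  "ext_cell M F = (THE E. E \<in> M \<and> F \<subseteq> frontier E)"

text \<open>The cell has a boundary part of positive length in common with the domain.\<close>

definition at_boundary :: "plane set \<Rightarrow> plane set set \<Rightarrow> plane set \<Rightarrow> bool" where
  "at_boundary \<Omega> M E \<longleftrightarrow> E \<in> M \<and> (\<exists>F\<in>ext_faces \<Omega> M. F \<subseteq> frontier E)"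

text \<open>An orientation is the choice of the inner cell of each internal face.\<close>

definition is_orientation :: "plane set set \<Rightarrow> (plane set \<Rightarrow> plane set) \<Rightarrow> bool" where
  "is_orientation M inn \<longleftrightarrow> (\<forall>F\<in>int_faces M. inn F \<in> M \<and> F \<subseteq> frontier (inn F))"

text \<open>Arc length integral over a segment \<open>F\<close>; the choice of the end points does not matter.\<close>

definition face_integral :: "plane set \<Rightarrow> (plane \<Rightarrow> 'b::euclidean_space) \<Rightarrow> 'b" where
  "face_integral F f =
     (let p = (SOME p. F = closed_segment (fst p) (snd p))
      in dist (fst p) (snd p) *\<^sub>R integral {0..1} (\<lambda>s. f (linepath (fst p) (snd p) s)))"

section \<open>Discrete functions\<close>

text \<open>Elements are represented by functions that are constant on each open cell; their values on
  the null set \<open>\<Omega> - \<Union>M\<close> are irrelevant.\<close>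

definition V0 :: "plane set \<Rightarrow> plane set set \<Rightarrow> (plane \<Rightarrow> real^'m) set" where
  "V0 \<Omega> M = {v. v \<in> borel_measurable (lebesgue_on \<Omega>) \<and>
     integrable (lebesgue_on \<Omega>) (\<lambda>x. (norm (v x))\<^sup>2) \<and> (\<forall>E\<in>M. v constant_on E)}"

definition L2_inner :: "plane set \<Rightarrow> (plane \<Rightarrow> real^'m) \<Rightarrow> (plane \<Rightarrow> real^'m) \<Rightarrow> real" where
  "L2_inner \<Omega> v w = integral\<^sup>L (lebesgue_on \<Omega>) (\<lambda>x. v x \<bullet> w x)"

definition L2_norm :: "plane set \<Rightarrow> (plane \<Rightarrow> real^'m) \<Rightarrow> real" where
  "L2_norm \<Omega> v = sqrt (integral\<^sup>L (lebesgue_on \<Omega>) (\<lambda>x. (norm (v x))\<^sup>2))"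

definition cell_value :: "(plane \<Rightarrow> real^'m) \<Rightarrow> plane set \<Rightarrow> real^'m" where
  "cell_value v E = the_elem (v ` E)"

definition nb_value ::
  "plane set set \<Rightarrow> (plane \<Rightarrow> real^'m) \<Rightarrow> plane set \<Rightarrow> plane set \<Rightarrow> real^'m" where
  "nb_value M v E F = (if F \<in> int_faces M then cell_value v (neighbor M E F) else 0)"

definition average ::
  "plane set set \<Rightarrow> (plane set \<Rightarrow> plane set) \<Rightarrow> (plane \<Rightarrow> real^'m) \<Rightarrow> plane set \<Rightarrow> real^'m" where
  "average M inn v F =
     (1/2) *\<^sub>R (cell_value v (inn F) + cell_value v (neighbor M (inn F) F))"

definition jump ::
  "plane set set \<Rightarrow> (plane set \<Rightarrow> plane set) \<Rightarrow> (plane \<Rightarrow> real^'m) \<Rightarrow> plane set \<Rightarrow> real^'m" where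
  "jump M inn v F = cell_value v (inn F) - cell_value v (neighbor M (inn F) F)"

section \<open>Flux matrices\<close>

definition diagonal_matrix :: "real^'m^'m \<Rightarrow> bool" where
  "diagonal_matrix D \<longleftrightarrow> (\<forall>i j. i \<noteq> j \<longrightarrow> D $ i $ j = 0)"

definition flux :: "real^'m^'m \<Rightarrow> real^'m^'m \<Rightarrow> plane \<Rightarrow> real^'m^'m" where
  "flux A B n = (n $ 1) *\<^sub>R A + (n $ 2) *\<^sub>R B"

definition sim_diag ::
  "real^'m^'m \<Rightarrow> real^'m^'m \<Rightarrow> real^'m^'m \<Rightarrow> (plane \<Rightarrow> real^'m^'m) \<Rightarrow> bool" where
  "sim_diag A B Q \<Lambda> \<longleftrightarrow> orthogonal_matrix Q \<and>
     (\<forall>n. norm n = 1 \<longrightarrow> diagonal_matrix (\<Lambda> n) \<and> flux A B n = Q ** \<Lambda> n ** transpose Q)"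

definition flux_pos :: "real^'m^'m \<Rightarrow> (plane \<Rightarrow> real^'m^'m) \<Rightarrow> plane \<Rightarrow> real^'m^'m" where
  "flux_pos Q \<Lambda> n =
     Q ** (\<chi> i j. if i = j then max 0 (\<Lambda> n $ i $ i) else 0) ** transpose Q"

definition flux_neg :: "real^'m^'m \<Rightarrow> (plane \<Rightarrow> real^'m^'m) \<Rightarrow> plane \<Rightarrow> real^'m^'m" where
  "flux_neg Q \<Lambda> n =
     Q ** (\<chi> i j. if i = j then min 0 (\<Lambda> n $ i $ i) else 0) ** transpose Q"

definition flux_abs :: "real^'m^'m \<Rightarrow> (plane \<Rightarrow> real^'m^'m) \<Rightarrow> plane \<Rightarrow> real^'m^'m" where
  "flux_abs Q \<Lambda> n = flux_pos Q \<Lambda> n - flux_neg Q \<Lambda> n"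

definition sym_psd :: "real^'m^'m \<Rightarrow> bool" where
  "sym_psd S \<longleftrightarrow> transpose S = S \<and> (\<forall>x. 0 \<le> (S *v x) \<bullet> x)"

section \<open>Semi-discrete forms\<close>

definition a_upw ::
  "plane set \<Rightarrow> plane set set \<Rightarrow> (plane set \<Rightarrow> plane set) \<Rightarrow> real^'m^'m \<Rightarrow> real^'m^'m \<Rightarrow>
   real^'m^'m \<Rightarrow> (plane \<Rightarrow> real^'m^'m) \<Rightarrow> (plane \<Rightarrow> real^'m) \<Rightarrow> (plane \<Rightarrow> real^'m) \<Rightarrow> real" where
  "a_upw \<Omega> M inn A B Q \<Lambda> u v =
     (\<Sum>F\<in>ext_faces \<Omega> M. face_integral F (\<lambda>_.
        (flux_pos Q \<Lambda> (outer_normal \<Omega> F) *v cell_value u (ext_cell M F))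
          \<bullet> cell_value v (ext_cell M F)))
   + (\<Sum>F\<in>int_faces M. face_integral F (\<lambda>_.
        (flux A B (outer_normal (inn F) F) *v average M inn u F) \<bullet> jump M inn v F
        + (1/2) * ((flux_abs Q \<Lambda> (outer_normal (inn F) F) *v jump M inn u F) \<bullet> jump M inn v F)))"

definition l_bdry ::
  "plane set \<Rightarrow> plane set set \<Rightarrow> real^'m^'m \<Rightarrow> (plane \<Rightarrow> real^'m^'m) \<Rightarrow>
   (plane \<Rightarrow> real^'m) \<Rightarrow> (plane \<Rightarrow> real^'m) \<Rightarrow> real" where
  "l_bdry \<Omega> M Q \<Lambda> g v =
     - (\<Sum>F\<in>ext_faces \<Omega> M. face_integral F (\<lambda>x.
          (flux_neg Q \<Lambda> (outer_normal \<Omega> F) *v g x) \<bullet> cell_value v (ext_cell M F)))"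

definition dod_cell ::
  "plane set \<Rightarrow> plane set set \<Rightarrow> real^'m^'m \<Rightarrow> (plane \<Rightarrow> real^'m^'m) \<Rightarrow> real \<Rightarrow>
   (plane set \<Rightarrow> real^'m^'m) \<Rightarrow> plane set \<Rightarrow> (plane \<Rightarrow> real^'m) \<Rightarrow> (plane \<Rightarrow> real^'m) \<Rightarrow> real" where
  "dod_cell \<Omega> M Q \<Lambda> \<eta> \<omega> E u v =
     \<eta> * (\<Sum>Fj\<in>cell_faces \<Omega> M E. face_integral Fj (\<lambda>_. \<Sum>Fi\<in>cell_faces \<Omega> M E.
        ((\<omega> Fi ** flux_pos Q \<Lambda> (outer_normal E Fj)) *v (nb_value M u E Fi - cell_value u E))
          \<bullet> (cell_value v E - nb_value M v E Fj)))"

definition dod_form ::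
  "plane set \<Rightarrow> plane set set \<Rightarrow> real^'m^'m \<Rightarrow> (plane \<Rightarrow> real^'m^'m) \<Rightarrow> plane set set \<Rightarrow>
   (plane set \<Rightarrow> real) \<Rightarrow> (plane set \<Rightarrow> plane set \<Rightarrow> real^'m^'m) \<Rightarrow>
   (plane \<Rightarrow> real^'m) \<Rightarrow> (plane \<Rightarrow> real^'m) \<Rightarrow> real" where
  "dod_form \<Omega> M Q \<Lambda> \<I> \<eta> \<omega> u v = (\<Sum>E\<in>\<I>. dod_cell \<Omega> M Q \<Lambda> (\<eta> E) (\<omega> E) E u v)"

definition dod_weights ::
  "plane set \<Rightarrow> plane set set \<Rightarrow> real^'m^'m \<Rightarrow> (plane \<Rightarrow> real^'m^'m) \<Rightarrow> plane set \<Rightarrow>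
   (plane set \<Rightarrow> real^'m^'m) \<Rightarrow> bool" where
  "dod_weights \<Omega> M Q \<Lambda> E \<omega> \<longleftrightarrow>
     (\<Sum>Fi\<in>cell_faces \<Omega> M E. \<omega> Fi) = mat 1 \<and>
     (\<forall>Fi\<in>cell_faces \<Omega> M E.
        (\<Sum>Fj\<in>cell_faces \<Omega> M E. face_integral Fj (\<lambda>_. \<omega> Fi ** flux_pos Q \<Lambda> (outer_normal E Fj)))
          = - face_integral Fi (\<lambda>_. flux_neg Q \<Lambda> (outer_normal E Fi))) \<and>
     (\<forall>Fi\<in>cell_faces \<Omega> M E. \<forall>Fj\<in>cell_faces \<Omega> M E.
        sym_psd (\<omega> Fi ** flux_pos Q \<Lambda> (outer_normal E Fj))) \<and>
     (CARD('m) = 1 \<longrightarrow> (\<forall>Fi\<in>cell_faces \<Omega> M E. \<forall>k l. 0 \<le> \<omega> Fi $ k $ l))"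

text \<open>Cut-cells arise by cutting cells of a background mesh with the boundary of the domain, so they
  have an external face. This is needed only for stabilized cells that are neighbors of each other:
  a chain of three stabilized cells away from the boundary can make the norm grow. Stabilized cells
  without external face are therefore admitted, provided none of their neighbors is stabilized.\<close>

definition stab_cells :: "plane set \<Rightarrow> plane set set \<Rightarrow> plane set set \<Rightarrow> bool" where
  "stab_cells \<Omega> M \<I> \<longleftrightarrow> \<I> \<subseteq> M \<and>
     (\<forall>E\<in>\<I>. \<forall>E'\<in>\<I>. E \<noteq> E' \<and> cell_faces \<Omega> M E \<inter> cell_faces \<Omega> M E' \<noteq> {}
        \<longrightarrow> at_boundary \<Omega> M E \<and> at_boundary \<Omega> M E')"

lemma stab_cells_cut:
  assumes "\<And>E. E \<in> \<I> \<Longrightarrow> at_boundary \<Omega> M E"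
  shows "stab_cells \<Omega> M \<I>"
  using assms unfolding stab_cells_def at_boundary_def by blast

text \<open>Since the mesh is finite, differentiability and continuity in time as an \<open>L\<^sup>2\<close>-valued map amount
  to those of the value on each cell.\<close>

definition is_dod_solution ::
  "plane set \<Rightarrow> real \<Rightarrow> plane set set \<Rightarrow> (plane set \<Rightarrow> plane set) \<Rightarrow> real^'m^'m \<Rightarrow> real^'m^'m \<Rightarrow>
   real^'m^'m \<Rightarrow> (plane \<Rightarrow> real^'m^'m) \<Rightarrow> plane set set \<Rightarrow> (plane set \<Rightarrow> real) \<Rightarrow>
   (plane set \<Rightarrow> plane set \<Rightarrow> real^'m^'m) \<Rightarrow> (real \<Rightarrow> plane \<Rightarrow> real^'m) \<Rightarrow>
   (real \<Rightarrow> plane \<Rightarrow> real^'m) \<Rightarrow> bool" where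
  "is_dod_solution \<Omega> T M inn A B Q \<Lambda> \<I> \<eta> \<omega> g u \<longleftrightarrow>
     (\<forall>t\<in>{0..<T}. u t \<in> V0 \<Omega> M) \<and>
     (\<forall>E\<in>M. \<forall>x\<in>E. continuous_on {0..<T} (\<lambda>t. u t x)) \<and>
     (\<forall>E\<in>M. \<forall>x\<in>E. \<forall>t\<in>{0<..<T}. (\<lambda>s. u s x) differentiable (at t)) \<and>
     (\<forall>t\<in>{0<..<T}. \<forall>v\<in>V0 \<Omega> M.
        L2_inner \<Omega> (\<lambda>x. vector_derivative (\<lambda>s. u s x) (at t)) v
        + a_upw \<Omega> M inn A B Q \<Lambda> (u t) v + dod_form \<Omega> M Q \<Lambda> \<I> \<eta> \<omega> (u t) v
        + l_bdry \<Omega> M Q \<Lambda> (g t) v = 0)"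

end

theory Submission
  imports Defs
begin

text \<open>The energy identity gives \<open>\<partial>\<^sub>t \<parallel>u\<^sub>h\<parallel>\<^sup>2 / 2 = - a\<^sub>h(u\<^sub>h, u\<^sub>h) - J\<^sub>h(u\<^sub>h, u\<^sub>h)\<close>, so the right-hand side must be
  nonpositive. By Gauss' theorem for constants, \<open>\<Sum>\<^sub>F |F| n\<^sub>F = 0\<close> on each cell off
  the boundary, the central fluxes of the upwind
  form cancel, and what remains is the dissipation \<open>\<onehalf> \<Sum>\<^sub>F |F| \<langle>|C\<^sub>F| \<lbrakk>u\<rbrakk>, \<lbrakk>u\<rbrakk>\<rangle>\<close>. With \<open>d\<^sub>i = u\<^sub>i - u\<^sub>E\<close> the stabilization of
  a cell is \<open>- \<eta> \<Sum>\<^sub>i\<^sub>j |F\<^sub>j| \<langle>\<omega>\<^sub>i C\<^sub>j\<^sup>+ d\<^sub>i, d\<^sub>j\<rangle>\<close>. The Cauchy inequality for the positive semidefinite \<open>\<omega>\<^sub>i C\<^sub>j\<^sup>+\<close>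
  and the sums over \<open>i\<close> and \<open>j\<close> prescribed for the weights bound it by the dissipation on the faces of the cell.\<close>

section \<open>Segments and normals\<close>

text \<open>Cells are bare open sets, so the geometry behind the algebra has to be derived: an
  internal face has exactly two cells, with opposite normals, and the faces of a cell off the
  boundary cover its frontier and overlap only in finitely many points. Both facts rest on the
  maximality of the segments and on the side condition in \<open>is_outer_normal\<close>. Cells may
  be nonconvex or have holes, so their boundary is not treated as a closed curve; Gauss' theorem
  comes from counting crossings with lines, for which local information at the faces suffices. The
  constants match exactly. On each face the Cauchy inequality and the weight conditions produce
  \<open>(C^+ - C^-) / 2 = |C| / 2\<close>, so for \<eta> = 1 the bound for a single stabilized cell
  takes up all the dissipation on its faces. A face between two stabilized cells therefore needs a
  separate reason. The zero values at the boundary serve twice: they provide this reason, and they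
  remove the cells whose internal faces alone need not form a closed boundary.\<close>

lemma infinite_obtain2:
  assumes "infinite S"
  obtains p q where "p \<in> S" "q \<in> S" "p \<noteq> q"
  using assms by (metis finite.emptyI finite.insertI finite_subset insertCI subsetI)

lemma collinear_Un_common:
  fixes S T :: "'a::euclidean_space set"
  assumes "collinear S" "collinear T" "p \<noteq> q" "{p, q} \<subseteq> S \<inter> T"
  shows "collinear (S \<union> T)"
proof -
  have "\<forall>x \<in> S \<union> T. collinear {p, q, x}"
    using assms by (auto intro: collinear_subset)
  then have "collinear (insert p (insert q (S \<union> T)))"
    using collinear_triples[OF \<open>p \<noteq> q\<close>] by blast
  then show ?thesis
    by (rule collinear_subset) auto
qed

text \<open>Two distinct common points put both segments on one line, and a compact connected
  collinear set is a segment.\<close>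

lemma closed_segment_Un:
  fixes a b c d :: "'a::euclidean_space"
  assumes "infinite (closed_segment a b \<inter> closed_segment c d)"
  obtains e f where "closed_segment a b \<union> closed_segment c d = closed_segment e f"
proof -
  obtain p q where pq: "p \<noteq> q" "{p, q} \<subseteq> closed_segment a b \<inter> closed_segment c d"
    using assms by (metis infinite_obtain2 empty_subsetI insert_subset)
  have "collinear (closed_segment a b \<union> closed_segment c d)"
    using collinear_Un_common[OF _ _ pq] by simp
  moreover have "connected (closed_segment a b \<union> closed_segment c d)"
    using pq by (intro connected_Un) auto
  moreover have "compact (closed_segment a b \<union> closed_segment c d)"
    by (intro compact_Un) auto
  ultimately show thesis
    using that by (rule_tac compact_convex_collinear_segment_alt[of "closed_segment a b \<union> closed_segment c d"]) auto
qed

lemma closed_segment_Int: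
  fixes a b c d :: "'a::euclidean_space"
  assumes "closed_segment a b \<inter> closed_segment c d \<noteq> {}"
  obtains e f where "closed_segment a b \<inter> closed_segment c d = closed_segment e f"
proof -
  have "collinear (closed_segment a b \<inter> closed_segment c d)"
    by (rule collinear_subset[OF collinear_closed_segment]) auto
  moreover have "connected (closed_segment a b \<inter> closed_segment c d)"
    by (intro convex_connected convex_Int) auto
  moreover have "compact (closed_segment a b \<inter> closed_segment c d)"
    by (intro compact_Int) auto
  ultimately show thesis
    using that assms
    by (rule_tac compact_convex_collinear_segment_alt[of "closed_segment a b \<inter> closed_segment c d"]) auto
qed

section \<open>Maximal segments of a plane set\<close>

text \<open>The union with an overlapping segment is again a segment inside \<open>X\<close>, so by
  maximality it adds nothing to \<open>F\<close>.\<close>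

lemma straight_pieces_absorb:
  assumes "F \<in> straight_pieces X" "closed_segment c d \<subseteq> X" "infinite (F \<inter> closed_segment c d)"
  shows "closed_segment c d \<subseteq> F"
proof -
  obtain a b where ab: "F = closed_segment a b" "closed_segment a b \<subseteq> X"
    and max: "\<And>c d. closed_segment a b \<subseteq> closed_segment c d \<Longrightarrow> closed_segment c d \<subseteq> X
        \<Longrightarrow> closed_segment c d = closed_segment a b"
    using assms(1) unfolding straight_pieces_def mem_Collect_eq by (elim exE conjE) metis
  obtain e f where ef: "closed_segment a b \<union> closed_segment c d = closed_segment e f"
    using closed_segment_Un[of a b c d] assms(3) unfolding ab(1) by blast
  have "closed_segment e f = closed_segment a b"
  proof (rule max)
    show "closed_segment a b \<subseteq> closed_segment e f" using ef by blast
    show "closed_segment e f \<subseteq> X" unfolding ef[symmetric] using ab assms(2) by simp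
  qed
  then show ?thesis using ef ab by blast
qed

lemma straight_piecesD:
  assumes "F \<in> straight_pieces X"
  obtains a b where "a \<noteq> b" "F = closed_segment a b" "F \<subseteq> X"
  using assms unfolding straight_pieces_def by auto

lemma straight_piece_subset: "F \<in> straight_pieces X \<Longrightarrow> F \<subseteq> X"
  by (rule straight_piecesD)

lemma infinite_straight_piece: "F \<in> straight_pieces X \<Longrightarrow> infinite F"
  by (metis straight_piecesD finite_closed_segment)

lemma straight_pieces_eq:
  assumes "F \<in> straight_pieces X" "G \<in> straight_pieces X" "infinite (F \<inter> G)"
  shows "F = G"
proof -
  obtain a b c d where "F = closed_segment a b" "G = closed_segment c d" "F \<subseteq> X" "G \<subseteq> X"
    using assms straight_piecesD by metis
  then show ?thesis
    using straight_pieces_absorb[OF assms(1)] straight_pieces_absorb[OF assms(2)] assms(3)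
    by (metis Int_commute subset_antisym)
qed

text \<open>Turns maximality of length into maximality under inclusion: two parameters in [0,1] at
  distance at least 1 must be 0 and 1.\<close>

lemma closed_segment_subset_dist_eq:
  fixes a b :: "'a::euclidean_space"
  assumes "closed_segment a b \<subseteq> closed_segment c d" "dist c d \<le> dist a b"
  shows "closed_segment c d = closed_segment a b"
proof -
  have "a \<in> closed_segment c d" "b \<in> closed_segment c d"
    using assms(1) by auto
  then obtain s t where st: "0 \<le> s" "s \<le> 1" "0 \<le> t" "t \<le> 1"
      "a = (1 - s) *\<^sub>R c + s *\<^sub>R d" "b = (1 - t) *\<^sub>R c + t *\<^sub>R d"
    by (auto simp: in_segment)
  have "a - b = (t - s) *\<^sub>R (c - d)"
    unfolding st(5,6) by (simp add: algebra_simps)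
  then have "dist a b = \<bar>t - s\<bar> * dist c d"
    by (simp add: dist_norm)
  then have "c = d \<or> 1 \<le> \<bar>t - s\<bar>"
    using assms(2) by (cases "c = d") (auto simp: mult_le_cancel_right1)
  then consider "c = d" | "s = 0" "t = 1" | "s = 1" "t = 0"
    using st by argo
  then show ?thesis
    by cases (use st closed_segment_commute in \<open>auto simp: algebra_simps\<close>)
qed

text \<open>Maximality is obtained by maximizing the length, which is possible as \<open>X\<close> is compact.\<close>

lemma straight_piece_exists:
  assumes X: "compact X" and "p \<noteq> q" and pq: "closed_segment p q \<subseteq> X"
  obtains F where "F \<in> straight_pieces X" "closed_segment p q \<subseteq> F"
proof -
  define K where "K = {z \<in> X \<times> X. closed_segment p q \<subseteq> closed_segment (fst z) (snd z)
      \<and> closed_segment (fst z) (snd z) \<subseteq> X}"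
  \<comment> \<open>Equality in the triangle inequality says that \<open>r\<close> lies on the
    segment; in this form it is a closed condition on the end points. Likewise \<open>D s\<close> is
    closed for each fixed parameter \<open>s\<close>. Hence \<open>K\<close> is compact.\<close>
  define C where "C r = {z. dist (fst z) (snd z) = dist (fst z) r + dist r (snd z)}" for r :: plane
  define D where "D s = (\<lambda>z. (1 - s) *\<^sub>R fst z + s *\<^sub>R snd z) -` X" for s :: real
  have C: "z \<in> C r \<longleftrightarrow> r \<in> closed_segment (fst z) (snd z)" for z r
    unfolding C_def using between between_mem_segment by (metis (mono_tags, lifting) mem_Collect_eq)
  have "K = (X \<times> X) \<inter> (C p \<inter> C q \<inter> (\<Inter>s\<in>{0..1}. D s))"
  proof (intro set_eqI iffI)
    fix z assume z: "z \<in> K"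
    then have "p \<in> closed_segment (fst z) (snd z)" "q \<in> closed_segment (fst z) (snd z)"
      unfolding K_def by auto
    moreover have "(1 - s) *\<^sub>R fst z + s *\<^sub>R snd z \<in> X" if "s \<in> {0..1}" for s
    proof -
      have "(1 - s) *\<^sub>R fst z + s *\<^sub>R snd z \<in> closed_segment (fst z) (snd z)"
        using that by (auto simp: in_segment)
      then show ?thesis using z unfolding K_def by blast
    qed
    ultimately show "z \<in> (X \<times> X) \<inter> (C p \<inter> C q \<inter> (\<Inter>s\<in>{0..1}. D s))"
      using z unfolding K_def D_def by (auto simp: C)
  next
    fix z assume "z \<in> (X \<times> X) \<inter> (C p \<inter> C q \<inter> (\<Inter>s\<in>{0..1}. D s))"
    then show "z \<in> K"
      unfolding K_def D_def by (auto simp: C in_segment(1) subset_closed_segment)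
  qed
  moreover have "closed (C r)" for r
    unfolding C_def by (intro closed_Collect_eq continuous_intros)
  moreover have "closed (D s)" for s
    unfolding D_def using compact_imp_closed[OF X]
    by (intro closed_vimage continuous_intros) auto
  ultimately have "compact K"
    using X by (auto intro!: compact_Int_closed closed_Int compact_Times)
  moreover have "(p, q) \<in> K" using pq by (auto simp: K_def)
  moreover have "continuous_on K (\<lambda>z. dist (fst z) (snd z))"
    by (intro continuous_intros)
  ultimately obtain z where z: "z \<in> K" "\<And>w. w \<in> K \<Longrightarrow> dist (fst w) (snd w) \<le> dist (fst z) (snd z)"
    using continuous_attains_sup[of K "\<lambda>z. dist (fst z) (snd z)"] by blast
  define F where "F = closed_segment (fst z) (snd z)"
  have ne: "fst z \<noteq> snd z"
  proof
    assume "fst z = snd z"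
    then have "closed_segment p q \<subseteq> {snd z}" using z(1) by (simp add: K_def)
    then show False using \<open>p \<noteq> q\<close> ends_in_segment[of p q] by blast
  qed
  have max: "closed_segment c d = F" if "F \<subseteq> closed_segment c d" "closed_segment c d \<subseteq> X" for c d
  proof -
    have "(c, d) \<in> K"
      using that z(1) by (auto simp: K_def F_def)
    then show ?thesis
      using closed_segment_subset_dist_eq[of "fst z" "snd z" c d] that(1) z(2) unfolding F_def
      by fastforce
  qed
  have "F \<in> straight_pieces X"
    unfolding straight_pieces_def mem_Collect_eq
  proof (intro exI conjI allI impI)
    show "F = closed_segment (fst z) (snd z)" by (fact F_def)
    show "fst z \<noteq> snd z" by (fact ne)
    show "closed_segment (fst z) (snd z) \<subseteq> X" using z(1) by (simp add: K_def)
    show "closed_segment c d = closed_segment (fst z) (snd z)"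
      if "closed_segment (fst z) (snd z) \<subseteq> closed_segment c d \<and> closed_segment c d \<subseteq> X" for c d
      using max[of c d] that by (simp add: F_def)
  qed
  moreover have "closed_segment p q \<subseteq> F"
    using z(1) by (auto simp: K_def F_def)
  ultimately show thesis using that by blast
qed

section \<open>Finite unions of segments\<close>

text \<open>Single points count as segments here, so that the class is closed under intersection.
  Interfaces between cells then belong to it along with the frontiers.\<close>

definition polysegment :: "plane set \<Rightarrow> bool" where
  "polysegment X \<longleftrightarrow> (\<exists>S. finite S \<and> (\<forall>s\<in>S. \<exists>a b. s = closed_segment a b) \<and> X = \<Union>S)"

lemma polysegment_Int:
  assumes "polysegment X" "polysegment Y"
  shows "polysegment (X \<inter> Y)"
proof -
  obtain S where S: "finite S" "\<And>s. s \<in> S \<Longrightarrow> \<exists>a b. s = closed_segment a b" "X = \<Union>S"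
    using assms(1) unfolding polysegment_def by blast
  obtain R where R: "finite R" "\<And>s. s \<in> R \<Longrightarrow> \<exists>a b. s = closed_segment a b" "Y = \<Union>R"
    using assms(2) unfolding polysegment_def by blast
  define K where "K = {s \<inter> r | s r. s \<in> S \<and> r \<in> R} - {{}}"
  have "K \<subseteq> (\<lambda>(s, r). s \<inter> r) ` (S \<times> R)" unfolding K_def by auto
  then have "finite K" using S R by (meson finite_SigmaI finite_imageI finite_subset)
  moreover have "\<exists>a b. k = closed_segment a b" if "k \<in> K" for k
    using that S(2) R(2) unfolding K_def by (smt (verit) DiffE closed_segment_Int mem_Collect_eq singletonI)
  moreover have "X \<inter> Y = \<Union>K" unfolding S R K_def by blast
  ultimately show ?thesis unfolding polysegment_def by blast
qed

lemma compact_polysegment: "polysegment X \<Longrightarrow> compact X"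
  unfolding polysegment_def by (metis compact_Union compact_segment)

text \<open>By the pigeonhole principle a maximal segment shares infinitely many points with one of
  the finitely many given segments, which it then absorbs. Two maximal segments absorbing the same
  one overlap and coincide, so this assignment is injective.\<close>

lemma finite_straight_pieces:
  assumes "polysegment X"
  shows "finite (straight_pieces X)"
proof -
  obtain S where S: "finite S" "\<And>s. s \<in> S \<Longrightarrow> \<exists>a b. s = closed_segment a b" "X = \<Union>S"
    using assms unfolding polysegment_def by blast
  have "\<exists>s\<in>S. infinite (F \<inter> s)" if F: "F \<in> straight_pieces X" for F
  proof (rule ccontr)
    assume "\<not> ?thesis"
    then have "finite (\<Union>s\<in>S. F \<inter> s)" using S(1) by blast
    moreover have "F = (\<Union>s\<in>S. F \<inter> s)"
      using straight_piece_subset[OF F] S(3) by blast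
    ultimately show False using infinite_straight_piece[OF F] by simp
  qed
  then obtain k where k: "\<And>F. F \<in> straight_pieces X \<Longrightarrow> k F \<in> S \<and> infinite (F \<inter> k F)"
    by metis
  have "inj_on k (straight_pieces X)"
  proof (rule inj_onI)
    fix F G assume F: "F \<in> straight_pieces X" and G: "G \<in> straight_pieces X" and eq: "k F = k G"
    have "k F \<subseteq> F" "k F \<subseteq> G"
      using straight_pieces_absorb[OF F] straight_pieces_absorb[OF G] k[OF F] k[OF G] eq S(2,3)
      by (metis Union_upper)+
    then have "infinite (F \<inter> G)"
      using k[OF F] by (meson Int_greatest Int_lower2 finite_subset)
    then show "F = G" using straight_pieces_eq F G by blast
  qed
  moreover have "k ` straight_pieces X \<subseteq> S" using k by blast
  ultimately show ?thesis using S(1) by (metis finite_imageD finite_subset)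
qed

text \<open>Every nondegenerate segment extends to a maximal one, so only degenerate segments, that
  is single points, can be missed.\<close>

lemma straight_pieces_cover:
  assumes "polysegment X"
  shows "finite (X - \<Union>(straight_pieces X))"
proof -
  obtain S where S: "finite S" "\<And>s. s \<in> S \<Longrightarrow> \<exists>a b. s = closed_segment a b" "X = \<Union>S"
    using assms unfolding polysegment_def by blast
  have "finite (s - \<Union>(straight_pieces X))" if s: "s \<in> S" for s
  proof -
    obtain a b where ab: "s = closed_segment a b" using S(2) s by blast
    show ?thesis
    proof (cases "a = b")
      case False
      then obtain F where "F \<in> straight_pieces X" "s \<subseteq> F"
        using straight_piece_exists[OF compact_polysegment[OF assms] False] ab S(3) s by blast
      then show ?thesis by (metis Diff_eq_empty_iff Sup_upper2 finite.emptyI)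
    qed (simp add: ab)
  qed
  then have "finite (\<Union>s\<in>S. s - \<Union>(straight_pieces X))" using S(1) by blast
  then show ?thesis unfolding S(3) by (rule rev_finite_subset) auto
qed

lemma negligible_polysegment:
  assumes "polysegment X"
  shows "negligible X"
proof -
  have "negligible (closed_segment a b)" for a b :: plane
    using negligible_convex_interior[of "closed_segment a b"] interior_closed_segment_ge2[of a b] by simp
  then show ?thesis
    using assms unfolding polysegment_def by (metis negligible_Union)
qed

section \<open>Outer normals\<close>

text \<open>Two vectors orthogonal to the same nonzero \<open>d\<close> have determinant zero.
  Lagrange's identity then gives \<open>(n \<bullet> m)\<^sup>2 = 1\<close>, the equality case of
  Cauchy-Schwarz.\<close>

lemma inner_eq_0_plane:
  fixes m n d :: plane
  assumes "d \<noteq> 0" "n \<bullet> d = 0" "m \<bullet> d = 0" "norm n = 1" "norm m = 1"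
  shows "m = n \<or> m = - n"
proof -
  have 1: "n$1 * n$1 + n$2 * n$2 = 1" "m$1 * m$1 + m$2 * m$2 = 1"
    using assms(4,5) by (simp_all add: norm_eq_1 inner_vec_def sum_2)
  have 2: "n$1 * d$1 + n$2 * d$2 = 0" "m$1 * d$1 + m$2 * d$2 = 0"
    using assms(2,3) by (simp_all add: inner_vec_def sum_2)
  have 3: "d$1 \<noteq> 0 \<or> d$2 \<noteq> 0"
    using assms(1) by (auto simp: vec_eq_iff forall_2)
  have 4: "(n$1 * m$2 - n$2 * m$1) * d$1 = 0" "(n$1 * m$2 - n$2 * m$1) * d$2 = 0"
    using 2 by algebra+
  then have 5: "n$1 * m$2 - n$2 * m$1 = 0" using 3 by auto
  have "(n$1 * m$1 + n$2 * m$2)\<^sup>2 = 1"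
    using 1 5 by algebra
  then have "n$1 * m$1 + n$2 * m$2 = 1 \<or> n$1 * m$1 + n$2 * m$2 = -1"
    by (simp add: power2_eq_1_iff)
  then have "n \<bullet> m = 1 \<or> n \<bullet> m = - 1"
    by (simp add: inner_vec_def sum_2)
  moreover have "(n - m) \<bullet> (n - m) = 2 - 2 * (n \<bullet> m)" "(n + m) \<bullet> (n + m) = 2 + 2 * (n \<bullet> m)"
    using assms(4,5) by (auto simp: inner_diff inner_add norm_eq_1 inner_commute)
  ultimately have "n - m = 0 \<or> n + m = 0"
    by (metis add.commute diff_self inner_eq_zero_iff mult_1_right mult_minus_right add.right_inverse)
  then show ?thesis
    by (auto simp: eq_neg_iff_add_eq_0 add.commute)
qed

lemma is_outer_normal_subset:
  assumes "is_outer_normal P F n" "G \<subseteq> F"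
  shows "is_outer_normal P G n"
  using assms unfolding is_outer_normal_def
  by (auto elim!: rev_finite_subset)

lemma is_outer_normal_parallel:
  assumes "infinite F" "is_outer_normal P F n" "is_outer_normal P' F n'"
  shows "n' = n \<or> n' = - n"
proof -
  obtain x y where "x \<in> F" "y \<in> F" "x - y \<noteq> 0"
    using infinite_obtain2[OF assms(1)] by (metis eq_iff_diff_eq_0)
  moreover have "n \<bullet> (x - y) = 0" "n' \<bullet> (x - y) = 0" "norm n = 1" "norm n' = 1"
    using assms(2,3) \<open>x \<in> F\<close> \<open>y \<in> F\<close> unfolding is_outer_normal_def by simp_all
  ultimately show ?thesis
    by (rule_tac inner_eq_0_plane)
qed

text \<open>Both exceptional sets are finite while \<open>F\<close> is infinite. At such a common
  good point the sides of \<open>P\<close> and \<open>P'\<close> can be compared.\<close>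

lemma is_outer_normal_generic:
  assumes "infinite F" "is_outer_normal P F n" "is_outer_normal P' F n'"
  obtains x where "x \<in> F" "\<forall>\<^sub>F e in at_right 0. x - e *\<^sub>R n \<in> P \<and> x + e *\<^sub>R n \<notin> P"
    "\<forall>\<^sub>F e in at_right 0. x - e *\<^sub>R n' \<in> P' \<and> x + e *\<^sub>R n' \<notin> P'"
proof -
  let ?B = "\<lambda>P n. {x\<in>F. \<not> (\<forall>\<^sub>F e in at_right 0. x - e *\<^sub>R n \<in> P \<and> x + e *\<^sub>R n \<notin> P)}"
  have "finite (?B P n \<union> ?B P' n')"
    using assms(2,3) unfolding is_outer_normal_def by blast
  then obtain x where "x \<in> F" "x \<notin> ?B P n \<union> ?B P' n'"
    using assms(1) by (meson finite_subset subsetI)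
  then show thesis using that by blast
qed

lemma is_outer_normal_unique:
  assumes "infinite F" "is_outer_normal P F n" "is_outer_normal P F n'"
  shows "n' = n"
proof (rule ccontr)
  assume "n' \<noteq> n"
  then have n': "n' = - n" using is_outer_normal_parallel[OF assms] by blast
  obtain x where "\<forall>\<^sub>F e in at_right 0. x - e *\<^sub>R n \<in> P \<and> x + e *\<^sub>R n \<notin> P"
    "\<forall>\<^sub>F e in at_right 0. x - e *\<^sub>R n' \<in> P \<and> x + e *\<^sub>R n' \<notin> P"
    by (rule is_outer_normal_generic[OF assms])
  then have "\<forall>\<^sub>F e in at_right (0::real). False"
    by eventually_elim (simp add: n')
  then show False by simp
qed

text \<open>With equal normals both sets would contain the points just behind a generic point of
  \<open>F\<close>.\<close>

lemma is_outer_normal_disjoint: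
  assumes "infinite F" "is_outer_normal P F n" "is_outer_normal P' F n'" "disjnt P P'"
  shows "n' = - n"
proof (rule ccontr)
  assume "n' \<noteq> - n"
  then have n': "n' = n" using is_outer_normal_parallel[OF assms(1-3)] by blast
  obtain x where "\<forall>\<^sub>F e in at_right 0. x - e *\<^sub>R n \<in> P \<and> x + e *\<^sub>R n \<notin> P"
    "\<forall>\<^sub>F e in at_right 0. x - e *\<^sub>R n' \<in> P' \<and> x + e *\<^sub>R n' \<notin> P'"
    by (rule is_outer_normal_generic[OF assms(1-3)])
  then have "\<forall>\<^sub>F e in at_right (0::real). False"
    by eventually_elim (use assms(4) n' in \<open>auto simp: disjnt_iff\<close>)
  then show False by simp
qed

text \<open>Three nonzero vectors cannot be pairwise opposite. This limits an internal face to two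
  cells.\<close>

lemma is_outer_normal_not_three:
  assumes "infinite F" "is_outer_normal P1 F n1" "is_outer_normal P2 F n2" "is_outer_normal P3 F n3"
    "disjnt P1 P2" "disjnt P1 P3" "disjnt P2 P3"
  shows False
proof -
  have "n2 = - n1" "n3 = - n1" "n3 = - n2"
    using is_outer_normal_disjoint assms by blast+
  then have "n1 = 0" by (simp add: eq_neg_iff_add_eq_0 flip: scaleR_2)
  then show False using assms(2) by (simp add: is_outer_normal_def)
qed

lemma outer_normal_eq:
  assumes "infinite F" "is_outer_normal P F n"
  shows "outer_normal P F = n"
  unfolding outer_normal_def using assms is_outer_normal_unique by blast

section \<open>Gauss' theorem for constants\<close>

text \<open>The function \<open>g\<close> may take stray values at isolated points. Its punctured
  limit \<open>h\<close> does not: it is locally constant, so it has derivative zero everywhere, and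
  it agrees with \<open>g\<close> near both ends.\<close>

lemma constant_if_punctured_constant:
  fixes g :: "real \<Rightarrow> real"
  assumes loc: "\<And>s. \<exists>L. \<forall>\<^sub>F r in at s. g r = L"
    and bot: "\<forall>\<^sub>F s in at_bot. g s = a" and top: "\<forall>\<^sub>F s in at_top. g s = b"
  shows "a = b"
proof -
  obtain h where h: "\<And>s. \<forall>\<^sub>F r in at s. g r = h s" using loc by metis
  have h_eq: "h s = c" if "open U" "s \<in> U" "\<And>r. r \<in> U \<Longrightarrow> r \<noteq> s \<Longrightarrow> g r = c" for s c U
  proof -
    have "\<forall>\<^sub>F r in at s. g r = c"
      using that by (auto simp: eventually_at_topological)
    with h[of s] have "\<forall>\<^sub>F r in at s. h s = c" by eventually_elim simp
    then show ?thesis by simp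
  qed
  have "(h has_field_derivative 0) (at s)" for s
  proof -
    obtain d where d: "d > 0" "\<And>r. r \<noteq> s \<Longrightarrow> dist r s < d \<Longrightarrow> g r = h s"
      using h[of s] unfolding eventually_at by auto
    have "h r = h s" if r: "r \<in> ball s d" for r
    proof (cases "r = s")
      case False
      show ?thesis
        by (rule h_eq[of "ball s d - {s}"]) (use d False r in \<open>auto simp: dist_commute\<close>)
    qed simp
    moreover have "((\<lambda>_. h s) has_field_derivative 0) (at s)" by simp
    ultimately show ?thesis
      using d(1) by (metis DERIV_const has_field_derivative_transform_within_open centre_in_ball open_ball)
  qed
  then have const: "h r = h s" for r s using DERIV_isconst_all by blast
  obtain A where A: "\<And>s. s \<le> A \<Longrightarrow> g s = a" using bot by (auto simp: eventually_at_bot_linorder)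
  obtain B where B: "\<And>s. s \<ge> B \<Longrightarrow> g s = b" using top by (auto simp: eventually_at_top_linorder)
  have "h (A - 1) = a" by (rule h_eq[of "{..<A}"]) (use A in auto)
  moreover have "h (B + 1) = b" by (rule h_eq[of "{B<..}"]) (use B in auto)
  ultimately show ?thesis using const by metis
qed

text \<open>Subtracting the expected jumps makes \<open>f\<close> constant up to single points.\<close>

lemma sum_jumps_eq_0:
  fixes f :: "real \<Rightarrow> real" and pos \<sigma> :: "'i \<Rightarrow> real"
  assumes "finite I" and inj: "inj_on pos I"
    and flat: "\<And>s. s \<notin> pos ` I \<Longrightarrow> \<exists>L. \<forall>\<^sub>F r in at s. f r = L"
    and jump: "\<And>i. i \<in> I \<Longrightarrow> \<exists>L. (\<forall>\<^sub>F r in at_left (pos i). f r = L) \<and>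
       (\<forall>\<^sub>F r in at_right (pos i). f r = L - \<sigma> i)"
    and bot: "\<forall>\<^sub>F s in at_bot. f s = 0" and top: "\<forall>\<^sub>F s in at_top. f s = 0"
  shows "sum \<sigma> I = 0"
proof -
  define H where "H i s = (if pos i < s then \<sigma> i else 0)" for i s
  define g where "g s = f s + (\<Sum>i\<in>I. H i s)" for s
  have H_flat: "\<forall>\<^sub>F r in at s. H i r = H i s" if "pos i \<noteq> s" for i s
  proof (cases "pos i < s")
    case True
    then have "\<forall>\<^sub>F r in at s. pos i < r"
      by (intro order_tendstoD[OF tendsto_ident_at])
    then show ?thesis by eventually_elim (use True in \<open>simp add: H_def\<close>)
  next
    case False
    then have "s < pos i" using that by simp
    then have "\<forall>\<^sub>F r in at s. r < pos i"
      by (intro order_tendstoD[OF tendsto_ident_at])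
    then show ?thesis by eventually_elim (use False in \<open>simp add: H_def\<close>)
  qed
  have sum_flat: "\<forall>\<^sub>F r in at s. (\<Sum>i\<in>J. H i r) = (\<Sum>i\<in>J. H i s)"
    if "J \<subseteq> I" "\<And>i. i \<in> J \<Longrightarrow> pos i \<noteq> s" for J s
  proof -
    have "finite J" using that(1) \<open>finite I\<close> finite_subset by blast
    then have "\<forall>\<^sub>F r in at s. \<forall>i\<in>J. H i r = H i s"
      using that(2) H_flat by (auto simp: eventually_ball_finite_distrib)
    then show ?thesis by eventually_elim (auto intro: sum.cong)
  qed
  \<comment> \<open>No step has been added at the left end and all of them at the right end, so
    equality of the two end values of \<open>g\<close> is the claim.\<close>
  have "0 = sum \<sigma> I"
  proof (rule constant_if_punctured_constant[of g])
    show "\<exists>L. \<forall>\<^sub>F r in at s. g r = L" for s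
    proof (cases "s \<in> pos ` I")
      case False
      obtain L where "\<forall>\<^sub>F r in at s. f r = L" using flat[OF False] by blast
      moreover have "\<forall>\<^sub>F r in at s. (\<Sum>i\<in>I. H i r) = (\<Sum>i\<in>I. H i s)"
        using False by (intro sum_flat) auto
      ultimately have "\<forall>\<^sub>F r in at s. g r = L + (\<Sum>i\<in>I. H i s)"
        by eventually_elim (simp add: g_def)
      then show ?thesis by blast
    next
      case True
      then obtain i where i: "i \<in> I" "s = pos i" by blast
      obtain L where L: "\<forall>\<^sub>F r in at_left s. f r = L" "\<forall>\<^sub>F r in at_right s. f r = L - \<sigma> i"
        using jump i by blast
      let ?S = "\<lambda>r. \<Sum>j\<in>I-{i}. H j r"
      \<comment> \<open>Injectivity of \<open>pos\<close> keeps the steps of the other indices flat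
        around \<open>s\<close>.\<close>
      have S: "\<forall>\<^sub>F r in at s. ?S r = ?S s"
        using inj i by (intro sum_flat) (auto simp: inj_on_def)
      have g: "g r = f r + H i r + ?S r" for r
        unfolding g_def using sum.remove[OF \<open>finite I\<close> i(1)] by simp
      have "\<forall>\<^sub>F r in at_left s. ?S r = ?S s" "\<forall>\<^sub>F r in at_right s. ?S r = ?S s"
        using S by (simp_all add: eventually_at_split)
      have "\<forall>\<^sub>F r in at_left s. g r = L + ?S s"
        using L(1) \<open>\<forall>\<^sub>F r in at_left s. ?S r = ?S s\<close> eventually_at_left_real[of "s - 1" s, simplified]
        by eventually_elim (simp add: g, simp add: H_def i)
      moreover have "\<forall>\<^sub>F r in at_right s. g r = L + ?S s"
        using L(2) \<open>\<forall>\<^sub>F r in at_right s. ?S r = ?S s\<close> eventually_at_right_real[of s "s + 1", simplified]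
        by eventually_elim (simp add: g, simp add: H_def i)
      ultimately show ?thesis by (auto simp: eventually_at_split)
    qed
    have "\<forall>\<^sub>F s in at_bot. \<forall>i\<in>I. s \<le> pos i"
      using \<open>finite I\<close> by (simp add: eventually_ball_finite_distrib eventually_le_at_bot)
    with bot show "\<forall>\<^sub>F s in at_bot. g s = 0"
      by eventually_elim (auto simp: g_def H_def intro!: sum.neutral)
    have "\<forall>\<^sub>F s in at_top. \<forall>i\<in>I. pos i < s"
      using \<open>finite I\<close> by (simp add: eventually_ball_finite_distrib eventually_gt_at_top)
    with top show "\<forall>\<^sub>F s in at_top. g s = sum \<sigma> I"
      by eventually_elim (auto simp: g_def H_def intro!: sum.cong)
  qed
  then show ?thesis by simp
qed

section \<open>Lines through a cell\<close>

text \<open>Near \<open>x\<close> the frontier of \<open>E\<close> lies in the line through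
  \<open>x\<close> orthogonal to \<open>n\<close>. Each open half disc avoids it and is connected,
  hence lies inside or outside \<open>E\<close>; one point on the normal through \<open>x\<close>
  decides which.\<close>

lemma half_balls:
  fixes E F :: "plane set"
  assumes n: "is_outer_normal E F n" and "x \<in> F"
    and x: "\<forall>\<^sub>F e in at_right 0. x - e *\<^sub>R n \<in> E \<and> x + e *\<^sub>R n \<notin> E"
    and "closed K" "x \<notin> K" "frontier E \<subseteq> F \<union> K"
  obtains r where "r > 0" "\<And>y. y \<in> ball x r \<Longrightarrow> n \<bullet> (y - x) < 0 \<Longrightarrow> y \<in> E"
    "\<And>y. y \<in> ball x r \<Longrightarrow> n \<bullet> (y - x) > 0 \<Longrightarrow> y \<notin> E"
proof -
  obtain r where r: "r > 0" "ball x r \<inter> K = {}"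
    using \<open>closed K\<close> \<open>x \<notin> K\<close> by (metis ComplI closed_def disjoint_eq_subset_Compl openE)
  have nn: "n \<bullet> n = 1" using n by (simp add: is_outer_normal_def norm_eq_1)
  have fr: "n \<bullet> (y - x) = 0" if "y \<in> frontier E" "y \<in> ball x r" for y
    using that assms r n unfolding is_outer_normal_def by blast
  have "\<forall>\<^sub>F e in at_right 0. e < r \<and> (0::real) < e"
    using r(1) by (auto simp: eventually_at_right_field)
  with x have "\<forall>\<^sub>F e in at_right 0. (x - e *\<^sub>R n \<in> E \<and> x + e *\<^sub>R n \<notin> E) \<and> e < r \<and> 0 < e"
    by (rule eventually_conj)
  then obtain e where e: "x - e *\<^sub>R n \<in> E" "x + e *\<^sub>R n \<notin> E" "0 < e" "e < r"
    using eventually_happens'[OF trivial_limit_at_right_real] by blast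
  have norm_n: "norm n = 1" using n by (simp add: is_outer_normal_def)
  let ?L = "ball x r \<inter> {y. n \<bullet> (y - x) < 0}" and ?R = "ball x r \<inter> {y. n \<bullet> (y - x) > 0}"
  have "?L = ball x r \<inter> {y. n \<bullet> y < n \<bullet> x}" "?R = ball x r \<inter> {y. n \<bullet> y > n \<bullet> x}"
    by (auto simp: inner_diff_right)
  then have "convex ?L" "convex ?R"
    by (auto intro!: convex_Int convex_halfspace_lt convex_halfspace_gt simp del: convex_Int)
  then have "connected ?L" "connected ?R" by (simp_all add: convex_connected)
  moreover have "?L \<inter> frontier E = {}" "?R \<inter> frontier E = {}" using fr by fastforce+
  moreover have "x - e *\<^sub>R n \<in> ?L \<inter> E" "x + e *\<^sub>R n \<in> ?R - E"
    using e norm_n nn by (auto simp: dist_norm)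
  ultimately have "?L - E = {}" "?R \<inter> E = {}"
    using connected_Int_frontier[of ?L E] connected_Int_frontier[of ?R E] by blast+
  then show thesis using that[OF r(1)] by blast
qed

text \<open>The vector \<open>p\<close> is \<open>e\<close> turned by a right angle, so the two form
  an orthonormal basis.\<close>

lemma plane_decomp:
  fixes e y :: plane
  assumes "norm e = 1"
  defines "p \<equiv> vector [- e$2, e$1]"
  shows "y = (y \<bullet> p) *\<^sub>R p + (y \<bullet> e) *\<^sub>R e"
proof -
  have "e$1 * e$1 + e$2 * e$2 = 1"
    using assms(1) by (simp add: norm_eq_1 inner_vec_def sum_2)
  then show ?thesis
    unfolding p_def by (simp add: vec_eq_iff forall_2 inner_vec_def sum_2) algebra
qed

lemma indicator_punctured_constant:
  fixes E :: "'a::real_normed_vector set"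
  assumes "a + s *\<^sub>R e \<notin> frontier E"
  shows "\<exists>L::real. \<forall>\<^sub>F r in at s. indicator E (a + r *\<^sub>R e) = L"
proof -
  have lim: "((\<lambda>r. a + r *\<^sub>R e) \<longlongrightarrow> a + s *\<^sub>R e) (at s)"
    by (intro tendsto_intros)
  consider "a + s *\<^sub>R e \<in> interior E" | "a + s *\<^sub>R e \<in> - closure E"
    using assms by (auto simp: frontier_def)
  then show ?thesis
  proof cases
    case 1
    have "\<forall>\<^sub>F r in at s. indicator E (a + r *\<^sub>R e) = (1::real)"
      using topological_tendstoD[OF lim open_interior 1]
      by eventually_elim (use interior_subset in \<open>auto simp: indicator_def\<close>)
    then show ?thesis by blast
  next
    case 2
    have "open (- closure E)" by auto
    have "\<forall>\<^sub>F r in at s. indicator E (a + r *\<^sub>R e) = (0::real)"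
      using topological_tendstoD[OF lim \<open>open (- closure E)\<close> 2]
      by eventually_elim (use closure_subset in \<open>auto simp: indicator_def\<close>)
    then show ?thesis by blast
  qed
qed

text \<open>On the line \<open>x \<bullet> p = c\<close>, run through in direction \<open>e\<close>,
  the indicator of \<open>E\<close> drops by \<open>sgn (\<nu> F \<bullet> e)\<close> where it
  crosses \<open>F\<close>. The drops cancel because \<open>E\<close> is bounded. The assumptions on
  \<open>c\<close> make the crossings clean: the line avoids uncovered frontier points, common
  points of faces, exceptional points of the normals, and faces parallel to it.\<close>

lemma slice_sum_eq_0:
  fixes E :: "plane set" and e :: plane
  defines "p \<equiv> vector [- e$2, e$1]"
  assumes e: "norm e = 1" and E: "bounded E" and fin: "finite \<F>"
    and cl: "\<And>F. F \<in> \<F> \<Longrightarrow> closed F"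
    and Z: "finite Z" and cover: "frontier E \<subseteq> \<Union>\<F> \<union> Z"
    and \<nu>: "\<And>F. F \<in> \<F> \<Longrightarrow> is_outer_normal E F (\<nu> F)"
    and c_Z: "\<And>x. x \<in> Z \<Longrightarrow> x \<bullet> p \<noteq> c"
    and c_Int: "\<And>F G x. F \<in> \<F> \<Longrightarrow> G \<in> \<F> \<Longrightarrow> F \<noteq> G \<Longrightarrow> x \<in> F \<inter> G \<Longrightarrow> x \<bullet> p \<noteq> c"
    and c_exc: "\<And>F x. F \<in> \<F> \<Longrightarrow> x \<in> F \<Longrightarrow> x \<bullet> p = c \<Longrightarrow>
       \<forall>\<^sub>F e in at_right 0. x - e *\<^sub>R \<nu> F \<in> E \<and> x + e *\<^sub>R \<nu> F \<notin> E"
    and c_par: "\<And>F x. F \<in> \<F> \<Longrightarrow> x \<in> F \<Longrightarrow> x \<bullet> p = c \<Longrightarrow> \<nu> F \<bullet> e \<noteq> 0"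
  shows "(\<Sum>F\<in>\<F>. sgn (\<nu> F \<bullet> e) * indicator ((\<lambda>x. x \<bullet> p) ` F) c) = 0"
proof -
  define I where "I = {F \<in> \<F>. c \<in> (\<lambda>x. x \<bullet> p) ` F}"
  define a where "a = c *\<^sub>R p"
  define f :: "real \<Rightarrow> real" where "f s = indicator E (a + s *\<^sub>R e)" for s
  have decomp: "y = (y \<bullet> p) *\<^sub>R p + (y \<bullet> e) *\<^sub>R e" for y
    using plane_decomp[OF e] unfolding p_def .
  have ee: "e \<bullet> e = 1" "p \<bullet> e = 0" "p \<bullet> p = 1"
    using e by (auto simp: norm_eq_1 inner_vec_def sum_2 p_def)
  have on_line: "(a + s *\<^sub>R e) \<bullet> p = c" "(a + s *\<^sub>R e) \<bullet> e = s" for s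
    using ee by (simp_all add: a_def inner_add_left inner_commute[of e p])
  have I_\<F>: "F \<in> \<F>" if "F \<in> I" for F using that by (simp add: I_def)
  have "\<exists>s. a + s *\<^sub>R e \<in> F" if F: "F \<in> I" for F
  proof -
    obtain x where "x \<in> F" "x \<bullet> p = c" using F by (auto simp: I_def)
    then show ?thesis using decomp[of x] unfolding a_def by metis
  qed
  then obtain pos where pos: "\<And>F. F \<in> I \<Longrightarrow> a + pos F *\<^sub>R e \<in> F" by metis
  have uniq: "pos F = s" if "F \<in> I" "a + s *\<^sub>R e \<in> F" for F s
  proof -
    have "\<nu> F \<bullet> ((a + pos F *\<^sub>R e) - (a + s *\<^sub>R e)) = 0"
      using \<nu>[of F] pos that I_\<F> unfolding is_outer_normal_def by blast
    then have "(pos F - s) * (\<nu> F \<bullet> e) = 0" by (simp add: inner_diff_right algebra_simps)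
    then show ?thesis using c_par[of F] that I_\<F> on_line by auto
  qed
  have not_other: "G = F" if "F \<in> I" "G \<in> \<F>" "a + pos F *\<^sub>R e \<in> G" for F G
    using c_Int[of F G "a + pos F *\<^sub>R e"] that pos I_\<F> on_line by auto
  have "sum (\<lambda>F. sgn (\<nu> F \<bullet> e)) I = 0"
  proof (rule sum_jumps_eq_0[of I pos f])
    show "finite I" using fin by (simp add: I_def)
    show "inj_on pos I" using not_other pos I_\<F> by (metis inj_onI)
    show "\<exists>L. \<forall>\<^sub>F r in at s. f r = L" if s: "s \<notin> pos ` I" for s
    proof -
      have "a + s *\<^sub>R e \<notin> frontier E"
      proof
        assume "a + s *\<^sub>R e \<in> frontier E"
        then consider "a + s *\<^sub>R e \<in> Z" | F where "F \<in> \<F>" "a + s *\<^sub>R e \<in> F" using cover by blast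
        then show False
        proof cases
          case 1
          then show ?thesis using c_Z on_line by blast
        next
          case 2
          then have "F \<in> I" unfolding I_def using on_line by (auto intro!: image_eqI[of _ _ "a + s *\<^sub>R e"])
          then show ?thesis using uniq 2 s by blast
        qed
      qed
      then show ?thesis unfolding f_def by (rule indicator_punctured_constant)
    qed
    show "\<exists>L. (\<forall>\<^sub>F r in at_left (pos F). f r = L) \<and>
       (\<forall>\<^sub>F r in at_right (pos F). f r = L - sgn (\<nu> F \<bullet> e))" if F: "F \<in> I" for F
    proof -
      let ?x = "a + pos F *\<^sub>R e" and ?K = "\<Union>(\<F> - {F}) \<union> Z"
      have "closed ?K"
        using fin cl Z by (intro closed_Un closed_Union finite_imp_closed) auto
      moreover have "?x \<notin> ?K" using not_other[OF F] c_Z on_line by blast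
      moreover have "frontier E \<subseteq> F \<union> ?K" using cover by blast
      ultimately obtain \<rho> where \<rho>: "\<rho> > 0"
        "\<And>y. y \<in> ball ?x \<rho> \<Longrightarrow> \<nu> F \<bullet> (y - ?x) < 0 \<Longrightarrow> y \<in> E"
        "\<And>y. y \<in> ball ?x \<rho> \<Longrightarrow> \<nu> F \<bullet> (y - ?x) > 0 \<Longrightarrow> y \<notin> E"
        using half_balls[OF \<nu>[OF I_\<F>[OF F]] pos[OF F] c_exc[OF I_\<F>[OF F] pos[OF F] on_line(1)]] by metis
      have diff: "(a + s *\<^sub>R e) - ?x = (s - pos F) *\<^sub>R e" for s by (simp add: algebra_simps)
      have in_ball: "a + s *\<^sub>R e \<in> ball ?x \<rho>" if "\<bar>s - pos F\<bar> < \<rho>" for s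
        using that e diff[of s] by (simp add: dist_norm norm_minus_commute)
      have f1: "f s = 1" if "\<bar>s - pos F\<bar> < \<rho>" "(s - pos F) * (\<nu> F \<bullet> e) < 0" for s
        using \<rho>(2)[OF in_ball[OF that(1)]] that(2) unfolding f_def diff by simp
      have f0: "f s = 0" if "\<bar>s - pos F\<bar> < \<rho>" "(s - pos F) * (\<nu> F \<bullet> e) > 0" for s
        using \<rho>(3)[OF in_ball[OF that(1)]] that(2) unfolding f_def diff by simp
      have left: "\<forall>\<^sub>F s in at_left (pos F). s \<in> {pos F - \<rho><..<pos F}"
        and right: "\<forall>\<^sub>F s in at_right (pos F). s \<in> {pos F<..<pos F + \<rho>}"
        using \<rho>(1) eventually_at_left_real[of "pos F - \<rho>" "pos F"]
          eventually_at_right_real[of "pos F" "pos F + \<rho>"] by simp_all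
      have "\<nu> F \<bullet> e \<noteq> 0" using c_par[OF I_\<F>[OF F] pos[OF F] on_line(1)] .
      \<comment> \<open>Moving along the outer normal the line leaves \<open>E\<close>, so the
        indicator falls from 1 to 0; moving against it the line enters. The witness is the value to
        the left of the crossing.\<close>
      then consider "\<nu> F \<bullet> e > 0" | "\<nu> F \<bullet> e < 0" by linarith
      then show ?thesis
      proof cases
        case 1
        have "\<forall>\<^sub>F s in at_left (pos F). f s = 1"
          using left by eventually_elim (use 1 in \<open>auto intro!: f1 mult_neg_pos\<close>)
        moreover have "\<forall>\<^sub>F s in at_right (pos F). f s = 0"
          using right by eventually_elim (use 1 in \<open>auto intro!: f0 mult_pos_pos\<close>)
        ultimately show ?thesis using 1 by (intro exI[of _ 1]) simp
      next
        case 2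
        have "\<forall>\<^sub>F s in at_left (pos F). f s = 0"
          using left by eventually_elim (use 2 in \<open>auto intro!: f0 mult_neg_neg\<close>)
        moreover have "\<forall>\<^sub>F s in at_right (pos F). f s = 1"
          using right by eventually_elim (use 2 in \<open>auto intro!: f1 mult_pos_neg\<close>)
        ultimately show ?thesis using 2 by (intro exI[of _ 0]) simp
      qed
    qed
    obtain R where R: "\<And>x. x \<in> E \<Longrightarrow> norm x \<le> R" using E by (auto simp: bounded_iff)
    have f0: "f s = 0" if "\<bar>s\<bar> > R" for s
    proof -
      \<comment> \<open>The parameter \<open>s\<close> is the component along \<open>e\<close> of
        the point on the line, so a large \<open>s\<close> means a point far from the
        origin.\<close>
      have "\<bar>s\<bar> \<le> norm (a + s *\<^sub>R e)"
        using on_line(2)[of s] Cauchy_Schwarz_ineq2[of "a + s *\<^sub>R e" e] e by simp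
      then show ?thesis using R[of "a + s *\<^sub>R e"] that by (auto simp: f_def indicator_def)
    qed
    show "\<forall>\<^sub>F s in at_bot. f s = 0"
      using eventually_gt_at_bot[of 0] eventually_gt_at_bot[of "- R"]
      by eventually_elim (auto intro: f0)
    show "\<forall>\<^sub>F s in at_top. f s = 0"
      using eventually_gt_at_top[of R] eventually_gt_at_top[of 0]
      by eventually_elim (auto intro: f0)
  qed
  also have "sum (\<lambda>F. sgn (\<nu> F \<bullet> e)) I =
      (\<Sum>F\<in>\<F>. sgn (\<nu> F \<bullet> e) * indicator ((\<lambda>x. x \<bullet> p) ` F) c)"
    unfolding I_def by (subst sum.inter_filter[OF fin]) (auto simp: indicator_def intro!: sum.cong)
  finally show ?thesis by simp
qed

section \<open>Lengths of faces and of their projections\<close>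

text \<open>The vector \<open>b - a\<close> is, up to sign, its length times \<open>n\<close> turned
  by a right angle, and turning both arguments by a right angle preserves the inner product with
  \<open>e\<close>.\<close>

lemma diameter_projection:
  fixes a b n e :: plane
  assumes "norm n = 1" "n \<bullet> (b - a) = 0"
  shows "\<bar>b \<bullet> vector [- e$2, e$1] - a \<bullet> vector [- e$2, e$1]\<bar> = dist a b * \<bar>n \<bullet> e\<bar>"
proof -
  define d where "d = b - a"
  have 1: "n$1 * n$1 + n$2 * n$2 = 1"
    using assms(1) by (simp add: norm_eq_1 inner_vec_def sum_2)
  have 2: "n$1 * d$1 + n$2 * d$2 = 0"
    using assms(2) by (simp add: inner_vec_def sum_2 d_def)
  have "(d \<bullet> vector [- e$2, e$1])\<^sup>2 = (d \<bullet> d) * (n \<bullet> e)\<^sup>2"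
    using 1 2 unfolding inner_vec_def sum_2 by simp algebra
  also have "\<dots> = (dist a b * \<bar>n \<bullet> e\<bar>)\<^sup>2"
    by (simp add: power_mult_distrib dist_norm norm_minus_commute[of a b] d_def power2_norm_eq_inner)
  finally have "\<bar>d \<bullet> vector [- e$2, e$1]\<bar> = \<bar>dist a b * \<bar>n \<bullet> e\<bar>\<bar>"
    by (simp only: abs_eq_iff power2_eq_iff)
  then show ?thesis by (simp add: d_def inner_diff_left)
qed

lemma image_inner_closed_segment:
  "(\<lambda>x. x \<bullet> p) ` closed_segment a b = closed_segment (a \<bullet> p) (b \<bullet> p)"
  by (rule closed_segment_linear_image[symmetric]) (simp add: linear_iff inner_add_left)

text \<open>Lets \<open>diameter F\<close> stand for the length of a face without a choice of end
  points.\<close>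

lemma diameter_closed_segment:
  fixes a b :: "'a::euclidean_space"
  shows "diameter (closed_segment a b) = dist a b"
proof (rule antisym)
  show "diameter (closed_segment a b) \<le> dist a b"
  proof (rule diameter_le)
    fix x y assume "x \<in> closed_segment a b" "y \<in> closed_segment a b"
    then obtain s t where st: "0 \<le> s" "s \<le> 1" "0 \<le> t" "t \<le> 1"
        "x = (1 - s) *\<^sub>R a + s *\<^sub>R b" "y = (1 - t) *\<^sub>R a + t *\<^sub>R b"
      by (auto simp: in_segment)
    have "x - y = (t - s) *\<^sub>R (a - b)"
      unfolding st(5,6) by (simp add: algebra_simps)
    then have "norm (x - y) = \<bar>t - s\<bar> * dist a b"
      by (simp add: dist_norm)
    also have "\<dots> \<le> 1 * dist a b"
      using st by (intro mult_right_mono) auto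
    finally show "norm (x - y) \<le> dist a b" by simp
  qed auto
  show "dist a b \<le> diameter (closed_segment a b)"
    by (rule diameter_bounded_bound) (auto simp: compact_imp_bounded)
qed

text \<open>Almost every line in direction \<open>e\<close> enters \<open>E\<close> as often as it leaves it. Integrating this over the
  lines weights each face with the length of its projection, \<open>|F| |\<nu>\<^sub>F \<bullet> e|\<close>.\<close>

theorem gauss_constant:
  fixes E :: "plane set"
  assumes E: "bounded E" and fin: "finite \<F>"
    and seg: "\<And>F. F \<in> \<F> \<Longrightarrow> \<exists>a b. F = closed_segment a b"
    and cover: "finite (frontier E - \<Union>\<F>)"
    and Int: "\<And>F G. F \<in> \<F> \<Longrightarrow> G \<in> \<F> \<Longrightarrow> F \<noteq> G \<Longrightarrow> finite (F \<inter> G)"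
    and \<nu>: "\<And>F. F \<in> \<F> \<Longrightarrow> is_outer_normal E F (\<nu> F)"
  shows "(\<Sum>F\<in>\<F>. diameter F *\<^sub>R \<nu> F) = 0"
proof -
  have "(\<Sum>F\<in>\<F>. diameter F *\<^sub>R \<nu> F) \<bullet> e = 0" if e: "norm e = 1" for e
  proof -
    define p :: plane where "p = vector [- e$2, e$1]"
    let ?exc = "\<lambda>F. {x\<in>F. \<not> (\<forall>\<^sub>F e in at_right 0. x - e *\<^sub>R \<nu> F \<in> E \<and> x + e *\<^sub>R \<nu> F \<notin> E)}"
    \<comment> \<open>The offsets of the lines to which \<open>slice_sum_eq_0\<close> does not
      apply. A face parallel to \<open>e\<close> projects to a single offset, so these are finitely
      many.\<close>
    define B where "B = (\<lambda>x. x \<bullet> p) ` ((frontier E - \<Union>\<F>) \<union> (\<Union>F\<in>\<F>. ?exc F) \<union>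
        (\<Union>F\<in>\<F>. \<Union>G\<in>\<F>-{F}. F \<inter> G)) \<union> (\<Union>F\<in>{F\<in>\<F>. \<nu> F \<bullet> e = 0}. (\<lambda>x. x \<bullet> p) ` F)"
    define w where "w c = (\<Sum>F\<in>\<F>. sgn (\<nu> F \<bullet> e) * indicator ((\<lambda>x. x \<bullet> p) ` F) c)" for c :: real
    have proj: "((\<lambda>c. indicator ((\<lambda>x. x \<bullet> p) ` F) c) has_integral diameter F * \<bar>\<nu> F \<bullet> e\<bar>) UNIV"
      and proj0: "\<nu> F \<bullet> e = 0 \<Longrightarrow> finite ((\<lambda>x. x \<bullet> p) ` F)" if F: "F \<in> \<F>" for F
    proof -
      obtain a b where ab: "F = closed_segment a b" using seg[OF F] by blast
      have "norm (\<nu> F) = 1" "\<nu> F \<bullet> (b - a) = 0"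
        using \<nu>[OF F] unfolding is_outer_normal_def ab by auto
      then have d: "diameter F * \<bar>\<nu> F \<bullet> e\<bar> = \<bar>b \<bullet> p - a \<bullet> p\<bar>"
        unfolding p_def ab diameter_closed_segment by (simp only: diameter_projection)
      have "((\<lambda>_. 1::real) has_integral \<bar>b \<bullet> p - a \<bullet> p\<bar>) (closed_segment (a \<bullet> p) (b \<bullet> p))"
        unfolding closed_segment_eq_real_ivl
        using has_integral_const_real[of "1::real" "a \<bullet> p" "b \<bullet> p"] has_integral_const_real[of "1::real" "b \<bullet> p" "a \<bullet> p"]
        by auto
      then show "((\<lambda>c. indicator ((\<lambda>x. x \<bullet> p) ` F) c) has_integral diameter F * \<bar>\<nu> F \<bullet> e\<bar>) UNIV"
        unfolding d unfolding ab image_inner_closed_segment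
        by (subst (asm) has_integral_restrict_UNIV[symmetric]) (simp add: indicator_def of_bool_def if_distrib)
      show "finite ((\<lambda>x. x \<bullet> p) ` F)" if "\<nu> F \<bullet> e = 0"
        using d that unfolding ab image_inner_closed_segment by simp
    qed
    have "finite (?exc F)" if "F \<in> \<F>" for F
      using \<nu>[OF that] unfolding is_outer_normal_def by blast
    then have "finite (\<Union>F\<in>\<F>. ?exc F)" using fin by blast
    moreover have "finite (\<Union>F\<in>\<F>. \<Union>G\<in>\<F>-{F}. F \<inter> G)"
      using fin Int by (intro finite_UN_I) auto
    moreover have "finite (\<Union>F\<in>{F\<in>\<F>. \<nu> F \<bullet> e = 0}. (\<lambda>x. x \<bullet> p) ` F)"
      using fin proj0 by (intro finite_UN_I) auto
    ultimately have "finite B"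
      unfolding B_def using cover by (intro finite_UnI finite_imageI)
    moreover have "w c = 0" if c: "c \<in> UNIV - B" for c
    proof -
      have Z: "x \<bullet> p \<noteq> c" if "x \<in> frontier E - \<Union>\<F>" for x
        using c that unfolding B_def by blast
      have Int: "x \<bullet> p \<noteq> c" if "F \<in> \<F>" "G \<in> \<F>" "F \<noteq> G" "x \<in> F \<inter> G" for F G x
      proof -
        have "x \<in> (\<Union>F\<in>\<F>. \<Union>G\<in>\<F>-{F}. F \<inter> G)" using that by blast
        then show ?thesis using c unfolding B_def by blast
      qed
      have exc: "\<forall>\<^sub>F e in at_right 0. x - e *\<^sub>R \<nu> F \<in> E \<and> x + e *\<^sub>R \<nu> F \<notin> E"
        if "F \<in> \<F>" "x \<in> F" "x \<bullet> p = c" for F x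
      proof (rule ccontr)
        assume "\<not> ?thesis"
        then have "x \<in> (\<Union>F\<in>\<F>. ?exc F)" using that by blast
        then show False using c that(3) unfolding B_def by blast
      qed
      have par: "\<nu> F \<bullet> e \<noteq> 0" if "F \<in> \<F>" "x \<in> F" "x \<bullet> p = c" for F x
        using c that unfolding B_def by blast
      have cl: "closed F" if "F \<in> \<F>" for F using seg[OF that] by auto
      have sub: "frontier E \<subseteq> \<Union>\<F> \<union> (frontier E - \<Union>\<F>)" by blast
      show ?thesis
        unfolding w_def p_def
        by (rule slice_sum_eq_0[OF e E fin cl cover sub \<nu> Z[unfolded p_def] Int[unfolded p_def]
            exc[unfolded p_def] par[unfolded p_def]])
    qed
    ultimately have "(w has_integral 0) UNIV"
      by (rule has_integral_spike_finite[OF _ _ has_integral_0])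
    moreover have "(w has_integral (\<Sum>F\<in>\<F>. sgn (\<nu> F \<bullet> e) * (diameter F * \<bar>\<nu> F \<bullet> e\<bar>))) UNIV"
      unfolding w_def using fin proj by (intro has_integral_sum has_integral_mult_right) auto
    ultimately have "0 = (\<Sum>F\<in>\<F>. sgn (\<nu> F \<bullet> e) * (diameter F * \<bar>\<nu> F \<bullet> e\<bar>))"
      by (rule has_integral_unique)
    \<comment> \<open>The sign of the crossing restores the sign that the projected length has
      lost.\<close>
    also have "\<dots> = (\<Sum>F\<in>\<F>. diameter F *\<^sub>R \<nu> F) \<bullet> e"
      by (auto simp: inner_sum_left sgn_if intro!: sum.cong)
    finally show ?thesis by simp
  qed
  note orth = this
  show ?thesis
  proof (rule ccontr)
    assume V: "(\<Sum>F\<in>\<F>. diameter F *\<^sub>R \<nu> F) \<noteq> 0" (is "?V \<noteq> 0")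
    \<comment> \<open>Tested in its own direction, the sum yields its norm.\<close>
    have "?V \<bullet> sgn ?V = 0" by (rule orth) (use V in \<open>simp add: norm_sgn\<close>)
    then show False using V by (simp add: sgn_div_norm)
  qed
qed

section \<open>Faces of a mesh\<close>

text \<open>Whichever end points the choice operator picks, they span the same segment, and their
  distance is its diameter.\<close>

lemma face_integral_const:
  "face_integral (closed_segment a b) (\<lambda>_. c) = diameter (closed_segment a b) *\<^sub>R c"
proof -
  define p where "p = (SOME p. closed_segment a b = closed_segment (fst p) (snd p))"
  have "closed_segment a b = closed_segment (fst p) (snd p)"
    unfolding p_def by (rule someI[of _ "(a, b)"]) simp
  then have "diameter (closed_segment a b) = dist (fst p) (snd p)"
    by (simp only: diameter_closed_segment)
  then show ?thesis
    unfolding face_integral_def Let_def p_def[symmetric] by simp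
qed

lemma face_integral_eq_0:
  assumes "F = closed_segment a b" "\<And>x. x \<in> F \<Longrightarrow> f x = 0"
  shows "face_integral F f = 0"
proof -
  define p where "p = (SOME p. F = closed_segment (fst p) (snd p))"
  have p: "F = closed_segment (fst p) (snd p)"
    unfolding p_def by (rule someI[of _ "(a, b)"]) (simp add: assms(1))
  have "f (linepath (fst p) (snd p) s) = 0" if "s \<in> {0..1}" for s
    using that assms(2) linepath_image_01[of "fst p" "snd p"] p by blast
  then have "integral {0..1} (\<lambda>s. f (linepath (fst p) (snd p) s)) = 0"
    using integral_cong[of "{0..1}" "\<lambda>s. f (linepath (fst p) (snd p) s)" "\<lambda>_. 0"] by simp
  then show ?thesis
    unfolding face_integral_def Let_def p_def[symmetric] by simp
qed

lemma polygonal_polysegment: "polygonal P \<Longrightarrow> polysegment (frontier P)"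
  unfolding polygonal_def polysegment_def by blast

locale mesh =
  fixes \<Omega> :: "plane set" and M :: "plane set set"
  assumes polygonal_domain: "polygonal \<Omega>" and is_mesh: "is_mesh \<Omega> M"
begin

lemma finite_cells: "finite M"
  and polygonal_cell: "E \<in> M \<Longrightarrow> polygonal E"
  and cell_subset: "E \<in> M \<Longrightarrow> E \<subseteq> \<Omega>"
  and disjoint_cells: "E \<in> M \<Longrightarrow> E' \<in> M \<Longrightarrow> E \<noteq> E' \<Longrightarrow> disjnt E E'"
  and closure_domain: "closure \<Omega> = (\<Union>E\<in>M. closure E)"
  and ex_outer_normal: "E \<in> M \<Longrightarrow> F \<in> cell_faces \<Omega> M E \<Longrightarrow> \<exists>n. is_outer_normal E F n"
  using is_mesh unfolding is_mesh_def pairwise_def by simp_all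

lemma open_cell: "E \<in> M \<Longrightarrow> open E"
  and bounded_cell: "E \<in> M \<Longrightarrow> bounded E"
  and cell_nonempty: "E \<in> M \<Longrightarrow> E \<noteq> {}"
  and interior_closure_cell: "E \<in> M \<Longrightarrow> interior (closure E) = E"
  using polygonal_cell unfolding polygonal_def by blast+

lemma polysegment_interface:
  "E \<in> M \<Longrightarrow> E' \<in> M \<Longrightarrow> polysegment (frontier E \<inter> frontier E')"
  "E \<in> M \<Longrightarrow> polysegment (frontier E \<inter> frontier \<Omega>)"
  by (intro polysegment_Int polygonal_polysegment polygonal_cell polygonal_domain; assumption)+

lemma int_faceE:
  assumes "F \<in> int_faces M"
  obtains E E' where "E \<in> M" "E' \<in> M" "E \<noteq> E'" "F \<in> straight_pieces (frontier E \<inter> frontier E')"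
  using assms unfolding int_faces_def by auto

lemma ext_faceE:
  assumes "F \<in> ext_faces \<Omega> M"
  obtains E where "E \<in> M" "F \<in> straight_pieces (frontier E \<inter> frontier \<Omega>)"
  using assms unfolding ext_faces_def by auto

lemma face_segment:
  assumes "F \<in> int_faces M \<union> ext_faces \<Omega> M"
  obtains a b where "a \<noteq> b" "F = closed_segment a b"
proof -
  obtain X where "F \<in> straight_pieces X"
    using assms int_faceE ext_faceE by (metis UnE)
  then show thesis using that straight_piecesD by metis
qed

lemma infinite_face: "F \<in> int_faces M \<union> ext_faces \<Omega> M \<Longrightarrow> infinite F"
  by (metis face_segment finite_closed_segment)

lemma face_integral_face:
  "F \<in> int_faces M \<union> ext_faces \<Omega> M \<Longrightarrow> face_integral F (\<lambda>_. c) = diameter F *\<^sub>R c"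
  by (metis face_segment face_integral_const)

lemma finite_int_faces: "finite (int_faces M)"
  unfolding int_faces_def
  by (intro finite_UN_I finite_Diff finite_cells finite_straight_pieces polysegment_interface) auto

lemma finite_ext_faces: "finite (ext_faces \<Omega> M)"
  unfolding ext_faces_def
  by (intro finite_UN_I finite_cells finite_straight_pieces polysegment_interface)

lemma finite_cell_faces: "finite (cell_faces \<Omega> M E)"
  unfolding cell_faces_def using finite_int_faces finite_ext_faces by simp

lemma outer_normal_face:
  assumes "E \<in> M" "F \<in> cell_faces \<Omega> M E"
  shows "is_outer_normal E F (outer_normal E F)"
proof -
  obtain n where n: "is_outer_normal E F n" using ex_outer_normal[OF assms] by blast
  have "infinite F" using assms(2) infinite_face unfolding cell_faces_def by blast
  then show ?thesis using n outer_normal_eq by metis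
qed

lemma int_face_in_cell_faces: "F \<in> int_faces M \<Longrightarrow> F \<subseteq> frontier E \<Longrightarrow> F \<in> cell_faces \<Omega> M E"
  by (simp add: cell_faces_def)

section \<open>The two cells of an internal face\<close>

text \<open>The three faces may differ; outer normals restrict to the common part \<open>H\<close>,
  where they are compared. This also covers faces that merely overlap.\<close>

lemma not_three_cells:
  assumes "infinite H" "E1 \<in> M" "E2 \<in> M" "E3 \<in> M" "E1 \<noteq> E2" "E1 \<noteq> E3" "E2 \<noteq> E3"
    and "F1 \<in> cell_faces \<Omega> M E1" "F2 \<in> cell_faces \<Omega> M E2" "F3 \<in> cell_faces \<Omega> M E3"
    and "H \<subseteq> F1" "H \<subseteq> F2" "H \<subseteq> F3"
  shows False
  using is_outer_normal_not_three[OF assms(1)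
    is_outer_normal_subset[OF outer_normal_face[OF assms(2,8)] assms(11)]
    is_outer_normal_subset[OF outer_normal_face[OF assms(3,9)] assms(12)]
    is_outer_normal_subset[OF outer_normal_face[OF assms(4,10)] assms(13)]]
    disjoint_cells assms(2-7) by blast

text \<open>The face comes from some pair of cells. As a third cell cannot have it in its frontier,
  \<open>E\<close> belongs to this pair, and the other member is the neighbor.\<close>

lemma ex_neighbor:
  assumes F: "F \<in> int_faces M" and E: "E \<in> M" "F \<subseteq> frontier E"
  obtains E' where "E' \<in> M" "E' \<noteq> E" "F \<in> straight_pieces (frontier E \<inter> frontier E')"
    "{G \<in> M. F \<subseteq> frontier G} = {E, E'}"
proof -
  obtain E1 E2 where E12: "E1 \<in> M" "E2 \<in> M" "E1 \<noteq> E2" "F \<in> straight_pieces (frontier E1 \<inter> frontier E2)"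
    using int_faceE[OF F] .
  have sub: "F \<subseteq> frontier E1" "F \<subseteq> frontier E2" using straight_piece_subset[OF E12(4)] by auto
  have inf: "infinite F" using F infinite_face by blast
  have two: "G = E1 \<or> G = E2" if "G \<in> M" "F \<subseteq> frontier G" for G
  proof (rule ccontr)
    assume "\<not> ?thesis"
    then have ne: "G \<noteq> E1" "G \<noteq> E2" by auto
    show False
      by (rule not_three_cells[OF inf that(1) E12(1,2) ne E12(3) int_face_in_cell_faces[OF F that(2)]
        int_face_in_cell_faces[OF F sub(1)] int_face_in_cell_faces[OF F sub(2)]]) auto
  qed
  then have cells: "{G \<in> M. F \<subseteq> frontier G} = {E1, E2}" using E12 sub by auto
  consider "E = E1" | "E = E2" using two E by blast
  then show thesis
  proof cases
    case 1
    then show ?thesis using that[of E2] E12 cells by simp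
  next
    case 2
    then show ?thesis using that[of E1] E12 cells by (simp add: Int_commute insert_commute)
  qed
qed

lemma
  assumes F: "F \<in> int_faces M" and E: "E \<in> M" "F \<subseteq> frontier E"
  shows neighbor_cell: "neighbor M E F \<in> M" "neighbor M E F \<noteq> E" "F \<subseteq> frontier (neighbor M E F)"
    and neighbor_piece: "F \<in> straight_pieces (frontier E \<inter> frontier (neighbor M E F))"
    and cells_of_face: "{G \<in> M. F \<subseteq> frontier G} = {E, neighbor M E F}"
proof -
  obtain E' where E': "E' \<in> M" "E' \<noteq> E" "F \<in> straight_pieces (frontier E \<inter> frontier E')"
    "{G \<in> M. F \<subseteq> frontier G} = {E, E'}"
    using ex_neighbor[OF assms] .
  have "neighbor M E F = E'"
    unfolding neighbor_def by (rule the_equality) (use E' in blast)+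
  then show "neighbor M E F \<in> M" "neighbor M E F \<noteq> E" "F \<subseteq> frontier (neighbor M E F)"
    "F \<in> straight_pieces (frontier E \<inter> frontier (neighbor M E F))"
    "{G \<in> M. F \<subseteq> frontier G} = {E, neighbor M E F}"
    using E' by blast+
qed

lemma neighbor_neighbor:
  assumes F: "F \<in> int_faces M" and E: "E \<in> M" "F \<subseteq> frontier E"
  shows "neighbor M (neighbor M E F) F = E"
  using cells_of_face[OF F neighbor_cell(1,3)[OF assms]] cells_of_face[OF assms]
    neighbor_cell[OF F neighbor_cell(1,3)[OF assms]] by (metis insert_iff singletonD doubleton_eq_iff)

lemma outer_normal_neighbor:
  assumes F: "F \<in> int_faces M" and E: "E \<in> M" "F \<subseteq> frontier E"
  shows "outer_normal (neighbor M E F) F = - outer_normal E F"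
proof (rule is_outer_normal_disjoint)
  show "infinite F" using F infinite_face by blast
  show "is_outer_normal E F (outer_normal E F)"
    using outer_normal_face E int_face_in_cell_faces[OF F] by blast
  show "is_outer_normal (neighbor M E F) F (outer_normal (neighbor M E F) F)"
    using outer_normal_face neighbor_cell[OF assms] int_face_in_cell_faces[OF F] by blast
  show "disjnt E (neighbor M E F)"
    using disjoint_cells neighbor_cell[OF assms] E(1) by metis
qed

text \<open>A point of \<open>\<Omega>\<close> away from the closures of all other cells has a
  neighborhood inside \<open>closure E\<close>. Since cells have no slits, it would be an interior
  point of \<open>E\<close> itself.\<close>

lemma frontier_cell_cases:
  assumes E: "E \<in> M" and x: "x \<in> frontier E"
  shows "x \<in> frontier \<Omega> \<or> (\<exists>E'\<in>M - {E}. x \<in> frontier E')"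
proof (cases "x \<in> \<Omega>")
  case False
  moreover have "x \<in> closure \<Omega>"
    using x E closure_domain by (auto simp: frontier_def)
  ultimately show ?thesis
    using polygonal_domain by (simp add: frontier_def polygonal_def interior_open)
next
  case True
  have xE: "x \<in> closure E" "x \<notin> E"
    using x open_cell[OF E] by (auto simp: frontier_def interior_open)
  define C where "C = (\<Union>E'\<in>M - {E}. closure E')"
  have "x \<in> C"
  proof (rule ccontr)
    assume "x \<notin> C"
    have "closed C" unfolding C_def using finite_cells by (intro closed_UN) auto
    then have "open (\<Omega> - C)" using polygonal_domain by (auto simp: polygonal_def)
    moreover have "\<Omega> - C \<subseteq> closure E"
      using closure_subset[of \<Omega>] unfolding closure_domain C_def by blast
    ultimately have "\<Omega> - C \<subseteq> E" using interior_closure_cell[OF E] interior_maximal by metis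
    then show False using True \<open>x \<notin> C\<close> xE(2) by blast
  qed
  then obtain E' where E': "E' \<in> M" "E' \<noteq> E" "x \<in> closure E'" unfolding C_def by blast
  have "x \<notin> E'"
    using open_Int_closure_eq_empty[OF open_cell[OF E'(1)]] disjoint_cells[OF E'(1) E E'(2)] xE(1)
    by (auto simp: disjnt_def)
  then show ?thesis using E' open_cell[OF E'(1)] by (auto simp: frontier_def interior_open)
qed

lemma interior_cell_faces:
  assumes E: "E \<in> M" "\<not> at_boundary \<Omega> M E"
  shows "cell_faces \<Omega> M E = {F \<in> int_faces M. F \<subseteq> frontier E}"
  using assms unfolding cell_faces_def at_boundary_def by blast

text \<open>To apply \<open>gauss_constant\<close>, the internal faces must exhaust the frontier up
  to finitely many points, and distinct faces must not overlap.\<close>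

lemma interior_cell_closed:
  assumes E: "E \<in> M" "\<not> at_boundary \<Omega> M E"
  shows "(\<Sum>F\<in>{F \<in> int_faces M. F \<subseteq> frontier E}. diameter F *\<^sub>R outer_normal E F) = 0"
proof (rule gauss_constant[OF bounded_cell[OF E(1)]])
  let ?\<F> = "{F \<in> int_faces M. F \<subseteq> frontier E}"
  show "finite ?\<F>" using finite_int_faces by simp
  show "\<exists>a b. F = closed_segment a b" if "F \<in> ?\<F>" for F
    using that face_segment[of F] by blast
  show "is_outer_normal E F (outer_normal E F)" if "F \<in> ?\<F>" for F
    using outer_normal_face[OF E(1)] that interior_cell_faces[OF E] by simp
  \<comment> \<open>By \<open>straight_pieces_cover\<close> the cell then has only finitely many
    frontier points on the boundary of the domain.\<close>
  have no_ext: "straight_pieces (frontier E \<inter> frontier \<Omega>) = {}"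
  proof (rule ccontr)
    assume "\<not> ?thesis"
    then obtain F where F: "F \<in> straight_pieces (frontier E \<inter> frontier \<Omega>)" by blast
    then have "F \<in> ext_faces \<Omega> M" using E(1) unfolding ext_faces_def by blast
    moreover have "F \<subseteq> frontier E" using straight_piece_subset[OF F] by blast
    ultimately show False using E unfolding at_boundary_def by blast
  qed
  have int: "F \<in> ?\<F>" if "E' \<in> M - {E}" "F \<in> straight_pieces (frontier E \<inter> frontier E')" for E' F
  proof -
    have "F \<in> int_faces M" using that E(1) unfolding int_faces_def by blast
    moreover have "F \<subseteq> frontier E" using straight_piece_subset[OF that(2)] by blast
    ultimately show ?thesis by blast
  qed
  let ?R = "\<lambda>X. X - \<Union>(straight_pieces X)"
  have "frontier E - \<Union>?\<F> \<subseteq> ?R (frontier E \<inter> frontier \<Omega>) \<union> (\<Union>E'\<in>M - {E}. ?R (frontier E \<inter> frontier E'))"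
  proof
    fix x assume x: "x \<in> frontier E - \<Union>?\<F>"
    then consider "x \<in> frontier \<Omega>" | E' where "E' \<in> M - {E}" "x \<in> frontier E'"
      using frontier_cell_cases[OF E(1)] by blast
    then show "x \<in> ?R (frontier E \<inter> frontier \<Omega>) \<union> (\<Union>E'\<in>M - {E}. ?R (frontier E \<inter> frontier E'))"
    proof cases
      case 1
      then show ?thesis using x no_ext by simp
    next
      case 2
      then have "x \<in> ?R (frontier E \<inter> frontier E')" using x int[OF 2(1)] by blast
      then show ?thesis using 2(1) by blast
    qed
  qed
  moreover have "finite (?R (frontier E \<inter> frontier \<Omega>) \<union> (\<Union>E'\<in>M - {E}. ?R (frontier E \<inter> frontier E')))"
    by (intro finite_UnI finite_UN_I finite_Diff[OF finite_cells] straight_pieces_cover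
        polysegment_interface E(1)) auto
  ultimately show "finite (frontier E - \<Union>?\<F>)" by (rule finite_subset)
  show "finite (F \<inter> G)" if F: "F \<in> ?\<F>" and G: "G \<in> ?\<F>" and "F \<noteq> G" for F G
  proof (rule ccontr)
    \<comment> \<open>There is no room for a third cell along the overlap, so both faces have the
      same neighbor. As overlapping maximal segments of one interface they coincide.\<close>
    assume inf: "infinite (F \<inter> G)"
    let ?E1 = "neighbor M E F" and ?E2 = "neighbor M E G"
    have 1: "?E1 \<in> M" "?E1 \<noteq> E" "F \<subseteq> frontier ?E1" "F \<in> straight_pieces (frontier E \<inter> frontier ?E1)"
      and 2: "?E2 \<in> M" "?E2 \<noteq> E" "G \<subseteq> frontier ?E2" "G \<in> straight_pieces (frontier E \<inter> frontier ?E2)"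
      using neighbor_cell[OF _ E(1)] neighbor_piece[OF _ E(1)] F G by auto
    have "F \<in> cell_faces \<Omega> M E" "F \<in> cell_faces \<Omega> M ?E1" "G \<in> cell_faces \<Omega> M ?E2"
      using int_face_in_cell_faces F G 1(3) 2(3) by auto
    then have "?E1 = ?E2"
      using not_three_cells[OF inf E(1) 1(1) 2(1) 1(2)[symmetric] 2(2)[symmetric]] by auto
    then have "F = G" using straight_pieces_eq[OF 1(4) _ inf] 2(4) by simp
    then show False using \<open>F \<noteq> G\<close> by blast
  qed
qed

end

section \<open>Flux matrices\<close>

text \<open>Moving \<open>Q\<close> to the other argument makes the form diagonal; signs and
  symmetry of the flux forms can be read off from \<open>d\<close>.\<close>

lemma conj_diagonal_inner:
  fixes Q :: "real^'n^'n"
  shows "((Q ** (\<chi> i j. if i = j then d i else 0) ** transpose Q) *v x) \<bullet> y =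
    (\<Sum>i\<in>UNIV. d i * (transpose Q *v x) $ i * (transpose Q *v y) $ i)"
proof -
  let ?D = "\<chi> i j. if i = j then d i else 0"
  have "((Q ** ?D ** transpose Q) *v x) \<bullet> y = (?D *v (transpose Q *v x)) \<bullet> (transpose Q *v y)"
    by (simp add: matrix_vector_mul_assoc[symmetric] dot_lmul_matrix[symmetric] dot_matrix_vector_mul
        inner_commute transpose_matrix_vector)
  moreover have "(?D *v z) $ i = d i * z $ i" for z i
    by (simp add: matrix_vector_mult_def if_distrib if_distribR cong: if_cong)
  ultimately show ?thesis by (simp add: inner_vec_def)
qed

lemma matrix_vector_sum_left:
  fixes S :: "'i \<Rightarrow> real^'n^'m"
  shows "(\<Sum>i\<in>I. S i) *v x = (\<Sum>i\<in>I. S i *v x)"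
  by (induction I rule: infinite_finite_induct) (simp_all add: matrix_vector_mult_add_rdistrib)

lemma matrix_add_rdistrib: "(A + B) ** C = A ** C + B ** (C :: 'a::semiring_1^'n^'m)"
  by (simp add: vec_eq_iff matrix_matrix_mult_def sum.distrib distrib_right)

lemma matrix_mult_uminus:
  fixes X :: "'a::ring_1^'n^'m" and Y :: "'a^'k^'n"
  shows "(- X) ** Y = - (X ** Y)" "X ** (- Y) = - (X ** Y)"
  by (simp_all add: matrix_matrix_mult_def vec_eq_iff sum_negf)

lemma matrix_vector_mult_uminus:
  fixes X :: "'a::ring_1^'n^'m"
  shows "(- X) *v y = - (X *v y)" "X *v (- y) = - (X *v y)"
  by (simp_all add: matrix_vector_mult_def vec_eq_iff sum_negf)

lemma matrix_mult_sum_left: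
  fixes S :: "'i \<Rightarrow> real^'n^'m" and P :: "real^'k^'n"
  shows "(\<Sum>i\<in>I. S i) ** P = (\<Sum>i\<in>I. S i ** P)"
  by (induction I rule: infinite_finite_induct) (simp_all add: matrix_add_rdistrib)

text \<open>Expand the nonnegative form at \<open>x - y\<close>; by symmetry the two mixed terms
  agree.\<close>

lemma sym_psd_cauchy:
  assumes "sym_psd S"
  shows "(S *v x) \<bullet> y \<le> ((S *v x) \<bullet> x + (S *v y) \<bullet> y) / 2"
proof -
  have "(S *v y) \<bullet> x = (S *v x) \<bullet> y"
    using assms unfolding sym_psd_def by (metis dot_lmul_matrix inner_commute transpose_matrix_vector)
  moreover have "0 \<le> (S *v (x - y)) \<bullet> (x - y)"
    using assms unfolding sym_psd_def by blast
  ultimately show ?thesis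
    by (simp add: matrix_vector_mult_diff_distrib inner_diff algebra_simps)
qed

text \<open>Cauchy's inequality splits each mixed term into one in \<open>d i\<close> alone, which
  is summed over \<open>j\<close> first, and one in \<open>d j\<close> alone, which is summed over
  \<open>i\<close> first. In the application \<open>P\<close> and \<open>N\<close> are the length of
  the face times \<open>C^+\<close> and \<open>- C^-\<close>, so that \<open>P + N\<close> is the
  length times \<open>|C|\<close>.\<close>

lemma sym_psd_double_sum:
  fixes S :: "'i \<Rightarrow> 'i \<Rightarrow> real^'n^'n" and d :: "'i \<Rightarrow> real^'n"
  assumes psd: "\<And>i j. i \<in> I \<Longrightarrow> j \<in> I \<Longrightarrow> sym_psd (S i j)"
    and row: "\<And>i. i \<in> I \<Longrightarrow> (\<Sum>j\<in>I. S i j) = N i"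
    and col: "\<And>j. j \<in> I \<Longrightarrow> (\<Sum>i\<in>I. S i j) = P j"
  shows "(\<Sum>j\<in>I. \<Sum>i\<in>I. (S i j *v d i) \<bullet> d j) \<le> (\<Sum>i\<in>I. ((P i + N i) *v d i) \<bullet> d i) / 2"
proof -
  have "(\<Sum>j\<in>I. \<Sum>i\<in>I. (S i j *v d i) \<bullet> d j)
      \<le> (\<Sum>j\<in>I. \<Sum>i\<in>I. ((S i j *v d i) \<bullet> d i + (S i j *v d j) \<bullet> d j) / 2)"
    by (intro sum_mono sym_psd_cauchy psd)
  also have "\<dots> = ((\<Sum>i\<in>I. \<Sum>j\<in>I. (S i j *v d i) \<bullet> d i) + (\<Sum>j\<in>I. \<Sum>i\<in>I. (S i j *v d j) \<bullet> d j)) / 2"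
    by (subst sum.swap) (simp add: sum.distrib flip: sum_divide_distrib add_divide_distrib)
  also have "(\<Sum>i\<in>I. \<Sum>j\<in>I. (S i j *v d i) \<bullet> d i) = (\<Sum>i\<in>I. (N i *v d i) \<bullet> d i)"
    by (intro sum.cong refl) (simp flip: row add: matrix_vector_sum_left inner_sum_left)
  also have "(\<Sum>j\<in>I. \<Sum>i\<in>I. (S i j *v d j) \<bullet> d j) = (\<Sum>j\<in>I. (P j *v d j) \<bullet> d j)"
    by (intro sum.cong refl) (simp flip: col add: matrix_vector_sum_left inner_sum_left)
  finally show ?thesis
    by (simp add: matrix_vector_mult_add_rdistrib inner_add_left sum.distrib add.commute)
qed

section \<open>Dependence of the flux matrices on the normal\<close>

lemma flux_uminus: "flux A B (- n) = - flux A B n"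
  by (simp add: flux_def algebra_simps)

lemma flux_pos_psd: "0 \<le> (flux_pos Q \<Lambda> n *v x) \<bullet> x"
  unfolding flux_pos_def conj_diagonal_inner by (intro sum_nonneg) (simp add: mult.assoc)

lemma flux_neg_nsd: "(flux_neg Q \<Lambda> n *v x) \<bullet> x \<le> 0"
  unfolding flux_neg_def conj_diagonal_inner
  by (intro sum_nonpos) (simp add: mult.assoc mult_nonpos_nonneg)

lemma flux_abs_psd: "0 \<le> (flux_abs Q \<Lambda> n *v x) \<bullet> x"
  using flux_pos_psd[of Q \<Lambda> n x] flux_neg_nsd[of Q \<Lambda> n x]
  by (simp add: flux_abs_def matrix_vector_mult_diff_rdistrib inner_diff_left)

lemma flux_eq_diagonal:
  assumes "sim_diag A B Q \<Lambda>" "norm n = 1"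
  shows "flux A B n = Q ** (\<chi> i j. if i = j then \<Lambda> n $ i $ i else 0) ** transpose Q"
proof -
  have "\<Lambda> n = (\<chi> i j. if i = j then \<Lambda> n $ i $ i else 0)"
    using assms unfolding sim_diag_def diagonal_matrix_def by (auto simp: vec_eq_iff)
  then show ?thesis using assms unfolding sim_diag_def by metis
qed

lemma flux_symmetric:
  assumes "sim_diag A B Q \<Lambda>" "norm n = 1"
  shows "(flux A B n *v x) \<bullet> y = (flux A B n *v y) \<bullet> x"
  unfolding flux_eq_diagonal[OF assms] conj_diagonal_inner by (simp add: mult_ac)

text \<open>Orthogonality of \<open>Q\<close> recovers \<open>\<Lambda> n\<close> from the flux
  matrix, which is odd in \<open>n\<close>. The two cells of a face see it with opposite
  normals.\<close>

lemma eigenvalues_uminus: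
  assumes "sim_diag A B Q \<Lambda>" "norm n = 1"
  shows "\<Lambda> (- n) = - \<Lambda> n"
proof -
  have Q: "transpose Q ** Q = mat 1" "Q ** transpose Q = mat 1"
    using assms(1) unfolding sim_diag_def orthogonal_matrix_def by auto
  have inv: "transpose Q ** (Q ** X ** transpose Q) ** Q = X" for X
    by (metis Q matrix_mul_assoc matrix_mul_lid matrix_mul_rid)
  have \<Lambda>: "\<Lambda> k = transpose Q ** flux A B k ** Q" if "norm k = 1" for k
    using assms(1) that inv[of "\<Lambda> k"] unfolding sim_diag_def by simp
  show ?thesis
    using assms(2) by (simp add: \<Lambda> flux_uminus matrix_mult_uminus)
qed

text \<open>Reversing the normal interchanges the positive and the negative part up to sign. The
  dissipation on a face is thus the same seen from either of its cells.\<close>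

lemma flux_abs_uminus:
  assumes "sim_diag A B Q \<Lambda>" "norm n = 1"
  shows "flux_abs Q \<Lambda> (- n) = flux_abs Q \<Lambda> n"
proof -
  have 1: "(\<chi> i j. if i = j then max 0 ((- \<Lambda> n) $ i $ i) else 0) =
      - (\<chi> i j. if i = j then min 0 (\<Lambda> n $ i $ i) else 0)"
    by (auto simp: vec_eq_iff)
  have 2: "(\<chi> i j. if i = j then min 0 ((- \<Lambda> n) $ i $ i) else 0) =
      - (\<chi> i j. if i = j then max 0 (\<Lambda> n $ i $ i) else 0)"
    by (auto simp: vec_eq_iff)
  show ?thesis
    unfolding flux_abs_def flux_pos_def flux_neg_def eigenvalues_uminus[OF assms] 1 2 matrix_mult_uminus
    by simp
qed

text \<open>For fixed \<open>x\<close> the quadratic form of the flux is linear in the normal,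
  namely the inner product with \<open>v\<close>.\<close>

lemma sum_flux_eq_0:
  assumes "(\<Sum>F\<in>I. w F *\<^sub>R n F) = 0"
  shows "(\<Sum>F\<in>I. w F * ((flux A B (n F) *v x) \<bullet> x)) = 0"
proof -
  define v :: plane where "v = vector [(A *v x) \<bullet> x, (B *v x) \<bullet> x]"
  have "(flux A B k *v x) \<bullet> x = k \<bullet> v" for k
    unfolding flux_def v_def
    by (simp add: matrix_vector_mult_add_rdistrib scaleR_matrix_vector_assoc[symmetric] inner_add_left
        inner_vec_def[of k] sum_2)
  then have "(\<Sum>F\<in>I. w F * ((flux A B (n F) *v x) \<bullet> x)) = (\<Sum>F\<in>I. w F *\<^sub>R n F) \<bullet> v"
    by (simp add: inner_sum_left)
  then show ?thesis using assms by simp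
qed

section \<open>Energy estimate\<close>

context mesh
begin

lemma norm_outer_normal:
  assumes "F \<in> int_faces M" "E \<in> M" "F \<subseteq> frontier E"
  shows "norm (outer_normal E F) = 1"
  using outer_normal_face[OF assms(2) int_face_in_cell_faces[OF assms(1,3)]]
  by (simp add: is_outer_normal_def)

lemma sum_int_faces_cells:
  fixes f :: "plane set \<Rightarrow> plane set \<Rightarrow> real"
  assumes "N \<subseteq> M"
  shows "(\<Sum>E\<in>N. \<Sum>F\<in>{F \<in> int_faces M. F \<subseteq> frontier E}. f E F) =
    (\<Sum>F\<in>int_faces M. \<Sum>E\<in>{E \<in> N. F \<subseteq> frontier E}. f E F)"
  using sum.swap_restrict[OF finite_subset[OF assms finite_cells] finite_int_faces] .

text \<open>Summed cell by cell: off the boundary the weighted normals add up to zero, and at the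
  boundary, where internal faces alone need not close up, the cell value is zero.\<close>

lemma sum_boundary_flux_eq_0:
  assumes bdry: "\<And>E. at_boundary \<Omega> M E \<Longrightarrow> U E = 0"
  shows "(\<Sum>F\<in>int_faces M. \<Sum>E\<in>{E \<in> M. F \<subseteq> frontier E}.
    diameter F * ((flux A B (outer_normal E F) *v U E) \<bullet> U E)) = 0"
  unfolding sum_int_faces_cells[OF subset_refl, symmetric]
proof (rule sum.neutral, rule ballI)
  fix E assume E: "E \<in> M"
  show "(\<Sum>F\<in>{F \<in> int_faces M. F \<subseteq> frontier E}.
    diameter F * ((flux A B (outer_normal E F) *v U E) \<bullet> U E)) = 0"
  proof (cases "at_boundary \<Omega> M E")
    case True
    then show ?thesis using bdry by simp
  next
    case False
    then show ?thesis using interior_cell_closed[OF E] by (intro sum_flux_eq_0) blast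
  qed
qed

text \<open>The central part of the flux sums up to boundary integrals over the cells, which vanish.\<close>

lemma a_upw_ge:
  fixes u :: "plane \<Rightarrow> real^'m"
  assumes AB: "sim_diag A B Q \<Lambda>" and inn: "is_orientation M inn"
    and bdry: "\<And>E. at_boundary \<Omega> M E \<Longrightarrow> cell_value u E = 0"
  shows "(\<Sum>F\<in>int_faces M. diameter F *
      ((flux_abs Q \<Lambda> (outer_normal (inn F) F) *v jump M inn u F) \<bullet> jump M inn u F)) / 2
    \<le> a_upw \<Omega> M inn A B Q \<Lambda> u u"
proof -
  define D where "D F = (flux_abs Q \<Lambda> (outer_normal (inn F) F) *v jump M inn u F) \<bullet> jump M inn u F" for F
  define c where "c F = (flux A B (outer_normal (inn F) F) *v average M inn u F) \<bullet> jump M inn u F" for F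
  have c: "c F = (\<Sum>E\<in>{E \<in> M. F \<subseteq> frontier E}.
      (flux A B (outer_normal E F) *v cell_value u E) \<bullet> cell_value u E) / 2" if F: "F \<in> int_faces M" for F
  proof -
    let ?E = "inn F" and ?E' = "neighbor M (inn F) F"
    have E: "?E \<in> M" "F \<subseteq> frontier ?E" using inn F unfolding is_orientation_def by auto
    let ?C = "flux A B (outer_normal ?E F)" and ?u = "cell_value u ?E" and ?u' = "cell_value u ?E'"
    have "(\<Sum>E\<in>{E \<in> M. F \<subseteq> frontier E}. (flux A B (outer_normal E F) *v cell_value u E) \<bullet> cell_value u E)
        = (?C *v ?u) \<bullet> ?u + (flux A B (outer_normal ?E' F) *v ?u') \<bullet> ?u'"
      unfolding cells_of_face[OF F E] using neighbor_cell(2)[OF F E] by simp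
    also have "\<dots> = (?C *v ?u) \<bullet> ?u - (?C *v ?u') \<bullet> ?u'"
      unfolding outer_normal_neighbor[OF F E] flux_uminus
      by (simp add: matrix_vector_mult_uminus)
    \<comment> \<open>By symmetry of the flux matrix the mixed terms in \<open>?u\<close> and
      \<open>?u'\<close> cancel.\<close>
    also have "\<dots> = (?C *v (?u + ?u')) \<bullet> (?u - ?u')"
      using flux_symmetric[OF AB norm_outer_normal[OF F E], of ?u ?u']
      by (simp add: matrix_vector_right_distrib inner_add_left inner_diff_right)
    finally show ?thesis
      unfolding c_def average_def jump_def
      by (simp add: matrix_vector_mult_scaleR)
  qed
  have "a_upw \<Omega> M inn A B Q \<Lambda> u u = (\<Sum>F\<in>ext_faces \<Omega> M. diameter F *
        ((flux_pos Q \<Lambda> (outer_normal \<Omega> F) *v cell_value u (ext_cell M F)) \<bullet> cell_value u (ext_cell M F)))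
      + (\<Sum>F\<in>int_faces M. diameter F * (c F + 1 / 2 * D F))"
    unfolding a_upw_def c_def D_def by (intro arg_cong2[where f="(+)"] sum.cong) (simp_all add: face_integral_face)
  moreover have "(\<Sum>F\<in>int_faces M. diameter F * c F) = 0"
  proof -
    have "(\<Sum>F\<in>int_faces M. diameter F * c F) = (\<Sum>F\<in>int_faces M. \<Sum>E\<in>{E \<in> M. F \<subseteq> frontier E}.
        diameter F * ((flux A B (outer_normal E F) *v cell_value u E) \<bullet> cell_value u E)) / 2"
      by (simp add: c sum_distrib_left sum_divide_distrib)
    then show ?thesis using sum_boundary_flux_eq_0[of "cell_value u", OF bdry] by simp
  qed
  \<comment> \<open>The outflow terms are nonnegative whatever cell \<open>ext_cell\<close>
    denotes.\<close>
  moreover have "0 \<le> (\<Sum>F\<in>ext_faces \<Omega> M. diameter F *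
        ((flux_pos Q \<Lambda> (outer_normal \<Omega> F) *v cell_value u (ext_cell M F)) \<bullet> cell_value u (ext_cell M F)))"
  proof (intro sum_nonneg mult_nonneg_nonneg flux_pos_psd)
    fix F assume "F \<in> ext_faces \<Omega> M"
    then show "0 \<le> diameter F"
      by (metis UnI2 face_segment diameter_closed_segment zero_le_dist)
  qed
  ultimately show ?thesis
    unfolding D_def[symmetric] by (simp add: distrib_left sum.distrib sum_divide_distrib)
qed

text \<open>Each stabilization term is absorbed by the upwind dissipation on the faces of its cell.\<close>

lemma dod_cell_ge:
  fixes u :: "plane \<Rightarrow> real^'m"
  assumes AB: "sim_diag A B Q \<Lambda>" and inn: "is_orientation M inn"
    and bdry: "\<And>E. at_boundary \<Omega> M E \<Longrightarrow> cell_value u E = 0"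
    and E: "E \<in> M" and \<eta>: "0 \<le> \<eta>" "\<eta> \<le> 1" and \<omega>: "dod_weights \<Omega> M Q \<Lambda> E \<omega>"
  shows "- (\<Sum>F\<in>{F \<in> int_faces M. F \<subseteq> frontier E}. diameter F *
      ((flux_abs Q \<Lambda> (outer_normal (inn F) F) *v jump M inn u F) \<bullet> jump M inn u F)) / 2
    \<le> dod_cell \<Omega> M Q \<Lambda> \<eta> \<omega> E u u"
proof -
  let ?\<F> = "cell_faces \<Omega> M E"
  define S where "S Fi Fj = diameter Fj *\<^sub>R (\<omega> Fi ** flux_pos Q \<Lambda> (outer_normal E Fj))" for Fi Fj
  define d where "d F = nb_value M u E F - cell_value u E" for F
  define D where "D F = (flux_abs Q \<Lambda> (outer_normal (inn F) F) *v jump M inn u F) \<bullet> jump M inn u F" for F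
  have face: "F \<in> int_faces M \<union> ext_faces \<Omega> M" if "F \<in> ?\<F>" for F
    using that by (simp add: cell_faces_def)
  have diam: "0 \<le> diameter F" if "F \<in> ?\<F>" for F
    using face[OF that] by (metis face_segment diameter_closed_segment zero_le_dist)
  have "dod_cell \<Omega> M Q \<Lambda> \<eta> \<omega> E u u = - \<eta> * (\<Sum>Fj\<in>?\<F>. \<Sum>Fi\<in>?\<F>. (S Fi Fj *v d Fi) \<bullet> d Fj)"
  proof -
    have "(S Fi Fj *v d Fi) \<bullet> d Fj = - (diameter Fj * (((\<omega> Fi ** flux_pos Q \<Lambda> (outer_normal E Fj)) *v
        (nb_value M u E Fi - cell_value u E)) \<bullet> (cell_value u E - nb_value M u E Fj)))" for Fi Fj
      unfolding S_def d_def
      by (simp add: scaleR_matrix_vector_assoc[symmetric] inner_diff_right algebra_simps del: matrix_vector_mult_diff_distrib)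
    then show ?thesis
      unfolding dod_cell_def
      by (simp add: face_integral_face[OF face] sum_distrib_left sum_negf cong: sum.cong)
  qed
  moreover have "(\<Sum>Fj\<in>?\<F>. \<Sum>Fi\<in>?\<F>. (S Fi Fj *v d Fi) \<bullet> d Fj)
      \<le> (\<Sum>F\<in>?\<F>. ((diameter F *\<^sub>R flux_pos Q \<Lambda> (outer_normal E F)
          + - (diameter F *\<^sub>R flux_neg Q \<Lambda> (outer_normal E F))) *v d F) \<bullet> d F) / 2"
  proof (rule sym_psd_double_sum)
    fix Fi Fj assume F: "Fi \<in> ?\<F>" "Fj \<in> ?\<F>"
    then have "sym_psd (\<omega> Fi ** flux_pos Q \<Lambda> (outer_normal E Fj))"
      using \<omega> unfolding dod_weights_def by blast
    then show "sym_psd (S Fi Fj)"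
      using diam[OF F(2)] unfolding S_def sym_psd_def
      by (simp add: transpose_scalar scaleR_matrix_vector_assoc[symmetric])
  next
    \<comment> \<open>The second weight condition gives the sums over \<open>Fj\<close>, the first
      one those over \<open>Fi\<close>.\<close>
    fix F assume F: "F \<in> ?\<F>"
    have "(\<Sum>Fj\<in>?\<F>. face_integral Fj (\<lambda>_. \<omega> F ** flux_pos Q \<Lambda> (outer_normal E Fj)))
        = - face_integral F (\<lambda>_. flux_neg Q \<Lambda> (outer_normal E F))"
      using \<omega> F unfolding dod_weights_def by blast
    then show "(\<Sum>Fj\<in>?\<F>. S F Fj) = - (diameter F *\<^sub>R flux_neg Q \<Lambda> (outer_normal E F))"
      unfolding S_def using F by (simp add: face_integral_face[OF face] cong: sum.cong)
    have "(\<Sum>Fi\<in>?\<F>. S Fi F) = diameter F *\<^sub>R ((\<Sum>Fi\<in>?\<F>. \<omega> Fi) ** flux_pos Q \<Lambda> (outer_normal E F))"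
      unfolding S_def matrix_mult_sum_left scaleR_sum_right ..
    also have "(\<Sum>Fi\<in>?\<F>. \<omega> Fi) = mat 1" using \<omega> unfolding dod_weights_def by blast
    finally show "(\<Sum>Fi\<in>?\<F>. S Fi F) = diameter F *\<^sub>R flux_pos Q \<Lambda> (outer_normal E F)"
      by (simp add: matrix_mul_lid)
  qed
  moreover have "(\<Sum>F\<in>?\<F>. ((diameter F *\<^sub>R flux_pos Q \<Lambda> (outer_normal E F)
          + - (diameter F *\<^sub>R flux_neg Q \<Lambda> (outer_normal E F))) *v d F) \<bullet> d F)
      = (\<Sum>F\<in>?\<F>. diameter F * ((flux_abs Q \<Lambda> (outer_normal E F) *v d F) \<bullet> d F))"
    by (simp add: flux_abs_def scaleR_matrix_vector_assoc[symmetric] flip: scaleR_diff_right)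
  \<comment> \<open>External faces drop out: a cell having one carries the value zero, and so does
    the missing outer neighbor by convention.\<close>
  moreover have "(\<Sum>F\<in>?\<F>. diameter F * ((flux_abs Q \<Lambda> (outer_normal E F) *v d F) \<bullet> d F))
      = (\<Sum>F\<in>{F \<in> int_faces M. F \<subseteq> frontier E}. diameter F * D F)"
  proof (rule sum.mono_neutral_cong_right)
    show "finite ?\<F>" by (rule finite_cell_faces)
    show "{F \<in> int_faces M. F \<subseteq> frontier E} \<subseteq> ?\<F>" by (auto simp: cell_faces_def)
    show "\<forall>F\<in>?\<F> - {F \<in> int_faces M. F \<subseteq> frontier E}.
        diameter F * ((flux_abs Q \<Lambda> (outer_normal E F) *v d F) \<bullet> d F) = 0"
    proof
      fix F assume F: "F \<in> ?\<F> - {F \<in> int_faces M. F \<subseteq> frontier E}"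
      then have "at_boundary \<Omega> M E" using E unfolding at_boundary_def cell_faces_def by blast
      moreover have "F \<notin> int_faces M" using F by (auto simp: cell_faces_def)
      ultimately have "d F = 0" using bdry by (simp add: d_def nb_value_def)
      then show "diameter F * ((flux_abs Q \<Lambda> (outer_normal E F) *v d F) \<bullet> d F) = 0" by simp
    qed
    fix F assume "F \<in> {F \<in> int_faces M. F \<subseteq> frontier E}"
    then have F: "F \<in> int_faces M" "F \<subseteq> frontier E" by auto
    have inn': "inn F \<in> M" "F \<subseteq> frontier (inn F)"
      using inn F(1) unfolding is_orientation_def by auto
    have "E \<in> {E \<in> M. F \<subseteq> frontier E}" using E F by blast
    \<comment> \<open>Seen from the inner cell \<open>d F\<close> is minus the jump, from the outer
      cell it is the jump with the normal reversed; the dissipation is the same.\<close>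
    then consider "E = inn F" | "E = neighbor M (inn F) F"
      unfolding cells_of_face[OF F(1) inn'] by blast
    then have "(flux_abs Q \<Lambda> (outer_normal E F) *v d F) \<bullet> d F = D F"
    proof cases
      case 1
      then have "d F = - jump M inn u F" using F by (simp add: d_def jump_def nb_value_def)
      then show ?thesis using 1 by (simp add: D_def matrix_vector_mult_uminus)
    next
      case 2
      then have "d F = jump M inn u F"
        using F neighbor_neighbor[OF F(1) inn'] by (simp add: d_def jump_def nb_value_def)
      then show ?thesis
        using 2 outer_normal_neighbor[OF F(1) inn'] flux_abs_uminus[OF AB norm_outer_normal[OF F(1) inn']]
        by (simp add: D_def)
    qed
    then show "diameter F * ((flux_abs Q \<Lambda> (outer_normal E F) *v d F) \<bullet> d F) = diameter F * D F"
      by simp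
  qed
  ultimately have J: "dod_cell \<Omega> M Q \<Lambda> \<eta> \<omega> E u u = - \<eta> * (\<Sum>Fj\<in>?\<F>. \<Sum>Fi\<in>?\<F>. (S Fi Fj *v d Fi) \<bullet> d Fj)"
    and le: "(\<Sum>Fj\<in>?\<F>. \<Sum>Fi\<in>?\<F>. (S Fi Fj *v d Fi) \<bullet> d Fj)
      \<le> (\<Sum>F\<in>{F \<in> int_faces M. F \<subseteq> frontier E}. diameter F * D F) / 2" (is "?s \<le> ?D / 2")
    by simp_all
  have "0 \<le> ?D"
  proof (intro sum_nonneg mult_nonneg_nonneg)
    show "0 \<le> D F" for F unfolding D_def by (rule flux_abs_psd)
  qed (use diam in \<open>auto simp: cell_faces_def\<close>)
  \<comment> \<open>The sign of \<open>?s\<close> is unknown, so \<open>\<eta> \<le> 1\<close> is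
    applied to its nonnegative bound instead.\<close>
  have "\<eta> * ?s \<le> \<eta> * (?D / 2)" using le \<eta>(1) by (rule mult_left_mono)
  also have "\<dots> \<le> 1 * (?D / 2)" using \<eta>(2) \<open>0 \<le> ?D\<close> by (intro mult_right_mono) auto
  finally show ?thesis unfolding J D_def[symmetric] by simp
qed

text \<open>The dissipation on a face is used up at most once, since two stabilized cells with a common face
  both touch the boundary and thus carry the value zero.\<close>

theorem stabilized_form_nonneg:
  fixes u :: "plane \<Rightarrow> real^'m"
  assumes AB: "sim_diag A B Q \<Lambda>" and inn: "is_orientation M inn"
    and bdry: "\<And>E. at_boundary \<Omega> M E \<Longrightarrow> cell_value u E = 0"
    and I: "stab_cells \<Omega> M \<I>" and \<eta>: "\<And>E. E \<in> \<I> \<Longrightarrow> \<eta> E \<in> {0..1}"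
    and \<omega>: "\<And>E. E \<in> \<I> \<Longrightarrow> dod_weights \<Omega> M Q \<Lambda> E (\<omega> E)"
  shows "0 \<le> a_upw \<Omega> M inn A B Q \<Lambda> u u + dod_form \<Omega> M Q \<Lambda> \<I> \<eta> \<omega> u u"
proof -
  define D where "D F = diameter F *
    ((flux_abs Q \<Lambda> (outer_normal (inn F) F) *v jump M inn u F) \<bullet> jump M inn u F)" for F
  have IM: "\<I> \<subseteq> M" using I unfolding stab_cells_def by blast
  have D0: "0 \<le> D F" if "F \<in> int_faces M" for F
    unfolding D_def using that
    by (intro mult_nonneg_nonneg flux_abs_psd) (metis UnI1 face_segment diameter_closed_segment zero_le_dist)
  have once: "(\<Sum>E\<in>{E \<in> \<I>. F \<subseteq> frontier E}. D F) \<le> D F" if F: "F \<in> int_faces M" for F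
  proof (cases "\<exists>E. {E \<in> \<I>. F \<subseteq> frontier E} \<subseteq> {E}")
    case True
    then obtain E where "{E \<in> \<I>. F \<subseteq> frontier E} \<subseteq> {E}" by blast
    then have "(\<Sum>E\<in>{E \<in> \<I>. F \<subseteq> frontier E}. D F) \<le> (\<Sum>E\<in>{E}. D F)"
      by (intro sum_mono2) (auto simp: D0[OF F])
    then show ?thesis by simp
  next
    case False
    define N where "N = {E \<in> \<I>. F \<subseteq> frontier E}"
    have "\<not> N \<subseteq> {E}" for E using False unfolding N_def by blast
    then obtain E E' where "E \<in> N" "E' \<in> N" "E \<noteq> E'" by blast
    then have E: "E \<in> \<I>" "F \<subseteq> frontier E" "E' \<in> \<I>" "F \<subseteq> frontier E'" "E \<noteq> E'"
      unfolding N_def by simp_all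
    then have "F \<in> cell_faces \<Omega> M E \<inter> cell_faces \<Omega> M E'"
      using int_face_in_cell_faces[OF F] by blast
    then have "at_boundary \<Omega> M E" "at_boundary \<Omega> M E'"
      using I E unfolding stab_cells_def by blast+
    then have 0: "cell_value u E = 0" "cell_value u E' = 0" using bdry by auto
    have inn': "inn F \<in> M" "F \<subseteq> frontier (inn F)"
      using inn F unfolding is_orientation_def by auto
    have "{E, E'} \<subseteq> {inn F, neighbor M (inn F) F}"
      using cells_of_face[OF F inn'] E IM by blast
    then have "cell_value u (inn F) = 0" "cell_value u (neighbor M (inn F) F) = 0"
      using 0 E(5) by auto
    then have "D F = 0" by (simp add: D_def jump_def)
    then show ?thesis by simp
  qed
  have "dod_form \<Omega> M Q \<Lambda> \<I> \<eta> \<omega> u u \<ge> (\<Sum>E\<in>\<I>. - (\<Sum>F\<in>{F \<in> int_faces M. F \<subseteq> frontier E}. D F) / 2)"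
    unfolding dod_form_def D_def
    by (intro sum_mono dod_cell_ge[OF AB inn bdry _ _ _ \<omega>]) (use IM \<eta> in auto)
  moreover have "(\<Sum>E\<in>\<I>. \<Sum>F\<in>{F \<in> int_faces M. F \<subseteq> frontier E}. D F) \<le> (\<Sum>F\<in>int_faces M. D F)"
    unfolding sum_int_faces_cells[OF IM] by (intro sum_mono once)
  moreover have "(\<Sum>F\<in>int_faces M. D F) / 2 \<le> a_upw \<Omega> M inn A B Q \<Lambda> u u"
    unfolding D_def by (rule a_upw_ge[OF AB inn bdry])
  ultimately show ?thesis by (simp add: sum_negf flip: sum_divide_distrib)
qed

section \<open>Integrals of cellwise constant functions and the boundary data\<close>

text \<open>What the cells leave out of \<open>\<Omega>\<close> lies in their frontiers, a null set,
  where \<open>f\<close> may be arbitrary, as is the time derivative of the solution. Measurability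
  of \<open>f\<close> follows from that of the step function \<open>g\<close>, since Lebesgue
  measure is complete.\<close>

lemma integral_piecewise_constant:
  fixes f :: "plane \<Rightarrow> real"
  assumes f: "\<And>E x. E \<in> M \<Longrightarrow> x \<in> E \<Longrightarrow> f x = c E"
  shows "integral\<^sup>L (lebesgue_on \<Omega>) f = (\<Sum>E\<in>M. measure lebesgue E * c E)"
proof -
  define g where "g x = (\<Sum>E\<in>M. indicator E x * c E)" for x
  have lmeas: "E \<in> lmeasurable" if "E \<in> M" for E
    using bounded_cell[OF that] open_cell[OF that] by (rule lmeasurable_open)
  have "open \<Omega>" using polygonal_domain by (simp add: polygonal_def)
  have "negligible (\<Union>E\<in>M. frontier E)"
    using finite_cells negligible_polysegment polygonal_polysegment polygonal_cell
    by (intro negligible_Union) auto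
  moreover have "\<Omega> - \<Union>M \<subseteq> (\<Union>E\<in>M. frontier E)"
  proof
    fix x assume x: "x \<in> \<Omega> - \<Union>M"
    then obtain E where "E \<in> M" "x \<in> closure E"
      using closure_subset[of \<Omega>] unfolding closure_domain by blast
    then show "x \<in> (\<Union>E\<in>M. frontier E)"
      using x open_cell by (auto simp: frontier_def interior_open)
  qed
  ultimately have "\<Omega> - \<Union>M \<in> null_sets lebesgue"
    using negligible_subset negligible_iff_null_sets by blast
  then have "AE x in lebesgue. x \<notin> \<Omega> - \<Union>M" by (rule AE_not_in)
  moreover have eq: "g x = indicator \<Omega> x *\<^sub>R f x" if "x \<notin> \<Omega> - \<Union>M" for x
  proof (cases "x \<in> \<Omega>")
    case True
    then obtain E where E: "E \<in> M" "x \<in> E" using \<open>x \<notin> \<Omega> - \<Union>M\<close> by blast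
    have "g x = (\<Sum>E'\<in>{E}. indicator E' x * c E')"
      unfolding g_def using E disjoint_cells[OF E(1)] finite_cells
      by (intro sum.mono_neutral_right) (auto simp: disjnt_iff indicator_def)
    then show ?thesis using E True f by simp
  next
    case False
    then have "x \<notin> E" if "E \<in> M" for E using cell_subset[OF that] by blast
    then show ?thesis using False by (simp add: g_def)
  qed
  ultimately have ae: "AE x in lebesgue. g x = indicator \<Omega> x *\<^sub>R f x"
    by (auto elim: eventually_mono)
  have "\<And>E. E \<in> M \<Longrightarrow> E \<in> sets lebesgue" using lmeas by blast
  then have g: "g \<in> borel_measurable lebesgue"
    unfolding g_def by (intro borel_measurable_sum borel_measurable_times borel_measurable_indicator) auto
  have "integral\<^sup>L (lebesgue_on \<Omega>) f = integral\<^sup>L lebesgue (\<lambda>x. indicator \<Omega> x *\<^sub>R f x)"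
    using \<open>open \<Omega>\<close> by (intro integral_restrict_space) simp
  also have "\<dots> = integral\<^sup>L lebesgue g"
    using g borel_measurable_AE[OF g ae] ae by (intro integral_cong_AE) auto
  also have "\<dots> = (\<Sum>E\<in>M. integral\<^sup>L lebesgue (\<lambda>x. indicator E x * c E))"
    unfolding g_def using lmeas
    by (intro Bochner_Integration.integral_sum integrable_mult_left integrable_real_indicator)
      (auto simp: fmeasurable_def simp del: emeasure_completion)
  also have "\<dots> = (\<Sum>E\<in>M. measure lebesgue E * c E)"
    by (intro sum.cong refl) (simp add: lmeas)
  finally show ?thesis .
qed

lemma l_bdry_eq_0:
  assumes "\<And>x. x \<in> frontier \<Omega> \<Longrightarrow> g x = 0"
  shows "l_bdry \<Omega> M Q \<Lambda> g v = 0"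
proof -
  have "face_integral F (\<lambda>x. (flux_neg Q \<Lambda> (outer_normal \<Omega> F) *v g x) \<bullet> cell_value v (ext_cell M F)) = 0"
    if F: "F \<in> ext_faces \<Omega> M" for F
  proof -
    obtain E where "F \<in> straight_pieces (frontier E \<inter> frontier \<Omega>)" using ext_faceE[OF F] .
    then have "F \<subseteq> frontier \<Omega>" using straight_piece_subset by blast
    moreover obtain a b where "F = closed_segment a b" using face_segment[of F] F by blast
    ultimately show ?thesis
      using assms by (intro face_integral_eq_0) auto
  qed
  then show ?thesis by (simp add: l_bdry_def)
qed

end

section \<open>Decay of the norm in time\<close>

theorem theorem3p1:
  fixes \<Omega> :: "plane set" and T :: real and M \<I> :: "plane set set"
    and inn :: "plane set \<Rightarrow> plane set"
    and A B Q :: "real^'m^'m" and \<Lambda> :: "plane \<Rightarrow> real^'m^'m"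
    and \<eta> :: "plane set \<Rightarrow> real" and \<omega> :: "plane set \<Rightarrow> plane set \<Rightarrow> real^'m^'m"
    and g u :: "real \<Rightarrow> plane \<Rightarrow> real^'m"
  assumes "polygonal \<Omega>" and "T > 0"
    and "sim_diag A B Q \<Lambda>"
    and "is_mesh \<Omega> M" and "is_orientation M inn"
    and "stab_cells \<Omega> M \<I>"
    and "\<And>E. E \<in> \<I> \<Longrightarrow> \<eta> E \<in> {0..1}"
    and "\<And>E. E \<in> \<I> \<Longrightarrow> dod_weights \<Omega> M Q \<Lambda> E (\<omega> E)"
    and "\<And>t x. t \<in> {0<..<T} \<Longrightarrow> x \<in> frontier \<Omega> \<Longrightarrow> g t x = 0"
    and "is_dod_solution \<Omega> T M inn A B Q \<Lambda> \<I> \<eta> \<omega> g u"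
    and "\<And>t E. t \<in> {0<..<T} \<Longrightarrow> at_boundary \<Omega> M E \<Longrightarrow> cell_value (u t) E = 0"
  shows "\<forall>t\<in>{0<..<T}. L2_norm \<Omega> (u t) \<le> L2_norm \<Omega> (u 0)"
proof
  interpret mesh \<Omega> M using assms(1,4) by unfold_locales
  note solution = \<open>is_dod_solution \<Omega> T M inn A B Q \<Lambda> \<I> \<eta> \<omega> g u\<close>[unfolded is_dod_solution_def]
  have V0: "u t \<in> V0 \<Omega> M" if "t \<in> {0..<T}" for t using solution that by blast
  \<comment> \<open>One sample point per cell reduces the discrete solution to finitely many
    functions of time, and \<open>e\<close> below becomes its squared norm.\<close>
  obtain p where p: "\<And>E. E \<in> M \<Longrightarrow> p E \<in> E" using cell_nonempty by (metis all_not_in_conv)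
  have const: "u t x = u t (p E)" if "t \<in> {0..<T}" "E \<in> M" "x \<in> E" for t E x
    using V0[OF that(1)] p[OF that(2)] that unfolding V0_def constant_on_def by auto
  define e where "e t = (\<Sum>E\<in>M. measure lebesgue E * (u t (p E) \<bullet> u t (p E)))" for t
  define u' where "u' t E = vector_derivative (\<lambda>s. u s (p E)) (at t)" for t E
  have norm: "L2_norm \<Omega> (u t) = sqrt (e t)" if "t \<in> {0..<T}" for t
    unfolding L2_norm_def e_def using const[OF that]
    by (subst integral_piecewise_constant) (auto simp: power2_norm_eq_inner)
  \<comment> \<open>All points of a cell carry the same function of time on an open interval around
    \<open>t\<close>, hence the same derivative.\<close>
  have deriv: "((\<lambda>s. u s x) has_vector_derivative u' t E) (at t)"
    if t: "t \<in> {0<..<T}" and E: "E \<in> M" "x \<in> E" for t E x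
  proof (rule has_vector_derivative_transform_within_open)
    show "((\<lambda>s. u s (p E)) has_vector_derivative u' t E) (at t)"
      using solution t E(1) p[OF E(1)] unfolding u'_def by (simp add: vector_derivative_works)
    show "u s (p E) = u s x" if "s \<in> {0<..<T}" for s
      using const[of s E x] that E by simp
  qed (use t in auto)
  fix t assume t: "t \<in> {0<..<T}"
  have "e t \<le> e 0"
  \<comment> \<open>Differentiability is given for positive times only; continuity takes care of the
    initial time.\<close>
  proof (rule DERIV_nonpos_imp_decreasing_open[where f = e])
    show "0 \<le> t" using t by simp
    have "continuous_on {0..t} (\<lambda>s. u s (p E))" if "E \<in> M" for E
    proof (rule continuous_on_subset)
      show "continuous_on {0..<T} (\<lambda>s. u s (p E))" using solution that p[OF that] by blast
    qed (use t in auto)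
    then show "continuous_on {0..t} e"
      unfolding e_def by (intro continuous_intros) auto
    fix s assume "0 < s" "s < t"
    then have s: "s \<in> {0<..<T}" "s \<in> {0..<T}" using t by auto
    have "((\<lambda>s. u s (p E) \<bullet> u s (p E)) has_real_derivative 2 * (u' s E \<bullet> u s (p E))) (at s)"
      if E: "E \<in> M" for E
    proof -
      have d: "((\<lambda>s. u s (p E)) has_derivative (\<lambda>h. h *\<^sub>R u' s E)) (at s)"
        using deriv[OF s(1) E p[OF E]] by (simp add: has_vector_derivative_def)
      show ?thesis
        using has_derivative_inner[OF d d] unfolding has_field_derivative_def
        by (rule has_derivative_eq_rhs) (auto simp: inner_commute)
    qed
    then have e': "(e has_real_derivative (\<Sum>E\<in>M. measure lebesgue E * (2 * (u' s E \<bullet> u s (p E))))) (at s)"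
      unfolding e_def by (intro DERIV_sum DERIV_cmult)
    have "L2_inner \<Omega> (\<lambda>x. vector_derivative (\<lambda>s. u s x) (at s)) (u s)
        = (\<Sum>E\<in>M. measure lebesgue E * (u' s E \<bullet> u s (p E)))"
      unfolding L2_inner_def
    proof (rule integral_piecewise_constant)
      fix E x assume E: "E \<in> M" "x \<in> E"
      show "vector_derivative (\<lambda>s. u s x) (at s) \<bullet> u s x = u' s E \<bullet> u s (p E)"
        using vector_derivative_at[OF deriv[OF s(1) E]] const[OF s(2) E] by simp
    qed
    \<comment> \<open>Testing with the solution itself gives the energy identity.\<close>
    moreover have "L2_inner \<Omega> (\<lambda>x. vector_derivative (\<lambda>s. u s x) (at s)) (u s)
        + a_upw \<Omega> M inn A B Q \<Lambda> (u s) (u s) + dod_form \<Omega> M Q \<Lambda> \<I> \<eta> \<omega> (u s) (u s)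
        + l_bdry \<Omega> M Q \<Lambda> (g s) (u s) = 0"
      using solution s V0 by blast
    moreover have "l_bdry \<Omega> M Q \<Lambda> (g s) (u s) = 0"
      by (rule l_bdry_eq_0) (use assms(9) s(1) in blast)
    moreover have "0 \<le> a_upw \<Omega> M inn A B Q \<Lambda> (u s) (u s) + dod_form \<Omega> M Q \<Lambda> \<I> \<eta> \<omega> (u s) (u s)"
      by (rule stabilized_form_nonneg) (use assms(3,5-8,11) s(1) in blast)+
    ultimately have "(\<Sum>E\<in>M. measure lebesgue E * (u' s E \<bullet> u s (p E))) \<le> 0" by simp
    then have "(\<Sum>E\<in>M. measure lebesgue E * (2 * (u' s E \<bullet> u s (p E)))) \<le> 0"
      by (simp add: mult.left_commute[of _ 2] flip: sum_distrib_left)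
    then show "\<exists>y. (e has_real_derivative y) (at s) \<and> y \<le> 0" using e' by blast
  qed
  then show "L2_norm \<Omega> (u t) \<le> L2_norm \<Omega> (u 0)"
    using norm[of t] norm[of 0] t by simp
qed

end
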